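(* Let $\mathcal{F}$ be a nonempty family of graphs with $\chi(\mathcal{F})=r+1\geq 3$. Let $0< \varepsilon < \frac{1}{2}$, $0<\sigma<\frac{\varepsilon^3}{7}$ and $0\leq \alpha\leq 1-\frac{1}{r}-\varepsilon$. For each $n$ let $\mathcal{G}'_n$ be the set of all $\mathcal{F}$-free graphs on $n$ vertices with minimum degree larger than $(\pi(\mathcal{F})-\varepsilon)n$, and $\lambda_\alpha(\mathcal{G}'_n)=\max_{H\in\mathcal{G}'_n}\lambda_\alpha(H)$. Suppose there exists $N>0$ such that for every $n>N$, $$\left|\mathrm{ex}(n,\mathcal{F})-\mathrm{ex}(n-1,\mathcal{F})-\pi(\mathcal{F})n\right|\leq \sigma n \quad\text{and}\quad \left|\lambda_{\alpha}(\mathcal{G}'_{n})-\frac{2\mathrm{ex}(n,\mathcal{F})}{n}\right|\leq \sigma.$$ Then there exists $n_{0}>0$ such that every $\mathcal{F}$-free graph $G$ on $n\geq n_0$ vertices satisfies $\lambda_{\alpha}(G)\leq \lambda_{\alpha}(\mathcal{G}'_{n})$; moreover, if equality holds then $G\in \mathcal{G}'_{n}$.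
   Context: $\lambda_\alpha(G)$ is the largest eigenvalue of $A_\alpha(G)=\alpha D(G)+(1-\alpha)A(G)$ ($A$ adjacency matrix, $D$ diagonal degree matrix). $\chi(\mathcal{F})=\min_{F\in\mathcal{F}}\chi(F)$. $\mathcal{F}$-free means containing no member of $\mathcal{F}$ as a subgraph. $\mathrm{ex}(n,\mathcal{F})$ is the maximum number of edges of an $\mathcal{F}$-free graph on $n$ vertices, and $\pi(\mathcal{F})=\lim_{n\to\infty}\mathrm{ex}(n,\mathcal{F})/\binom n2$ (which equals $1-\frac1r$ by the Erdős–Stone–Simonovits theorem). *)

theory Defs
  imports Complex_Main
begin

text \<open>A graph on n vertices is represented by its vertex count n (vertex set {..<n})
  and its edge set E, a set of 2-element subsets of {..<n}.\<close>

type_synonym graph = "nat \<times> nat set set"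

definition is_graph :: "nat \<Rightarrow> nat set set \<Rightarrow> bool" where
  "is_graph n E \<longleftrightarrow> (\<forall>e\<in>E. \<exists>u v. u < n \<and> v < n \<and> u \<noteq> v \<and> e = {u, v})"

definition wf_graph :: "graph \<Rightarrow> bool" where
  "wf_graph H \<longleftrightarrow> is_graph (fst H) (snd H)"

definition contains :: "graph \<Rightarrow> graph \<Rightarrow> bool" where
  "contains G H \<longleftrightarrow> (\<exists>f. inj_on f {..<fst H} \<and> f ` {..<fst H} \<subseteq> {..<fst G}
      \<and> (\<forall>e\<in>snd H. f ` e \<in> snd G))"

definition free :: "graph set \<Rightarrow> graph \<Rightarrow> bool" where
  "free \<F> G \<longleftrightarrow> (\<forall>H\<in>\<F>. \<not> contains G H)"

definition proper_colouring :: "graph \<Rightarrow> nat \<Rightarrow> (nat \<Rightarrow> nat) \<Rightarrow> bool" where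
  "proper_colouring H c col \<longleftrightarrow> (\<forall>v<fst H. col v < c)
     \<and> (\<forall>e\<in>snd H. \<forall>u\<in>e. \<forall>v\<in>e. u \<noteq> v \<longrightarrow> col u \<noteq> col v)"

definition chromatic_number :: "graph \<Rightarrow> nat" where
  "chromatic_number H = (LEAST c. \<exists>col. proper_colouring H c col)"

definition chromatic_number_fam :: "graph set \<Rightarrow> nat" where
  "chromatic_number_fam \<F> = (LEAST c. c \<in> chromatic_number ` \<F>)"

definition ex :: "nat \<Rightarrow> graph set \<Rightarrow> nat" where
  "ex n \<F> = Max {card E | E. is_graph n E \<and> free \<F> (n, E)}"

definition turan_density :: "graph set \<Rightarrow> real" where
  "turan_density \<F> = lim (\<lambda>n. real (ex n \<F>) / real (n choose 2))"

definition degree :: "nat set set \<Rightarrow> nat \<Rightarrow> nat" where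
  "degree E v = card {u. {u, v} \<in> E}"

definition A_alpha :: "real \<Rightarrow> nat set set \<Rightarrow> nat \<Rightarrow> nat \<Rightarrow> real" where
  "A_alpha \<alpha> E i j = \<alpha> * (if i = j then real (degree E i) else 0)
       + (1 - \<alpha>) * (if {i, j} \<in> E then 1 else 0)"

definition is_eigenvalue :: "nat \<Rightarrow> (nat \<Rightarrow> nat \<Rightarrow> real) \<Rightarrow> real \<Rightarrow> bool" where
  "is_eigenvalue n M \<mu> \<longleftrightarrow> (\<exists>x :: nat \<Rightarrow> real. (\<exists>i<n. x i \<noteq> 0)
       \<and> (\<forall>i<n. (\<Sum>j<n. M i j * x j) = \<mu> * x i))"

definition lambda_alpha :: "real \<Rightarrow> nat \<Rightarrow> nat set set \<Rightarrow> real" where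
  "lambda_alpha \<alpha> n E = Max {\<mu>. is_eigenvalue n (A_alpha \<alpha> E) \<mu>}"

definition G'_set :: "graph set \<Rightarrow> real \<Rightarrow> nat \<Rightarrow> nat set set set" where
  "G'_set \<F> \<epsilon> n = {E. is_graph n E \<and> free \<F> (n, E)
       \<and> (\<forall>v<n. real (degree E v) > (turan_density \<F> - \<epsilon>) * real n)}"

definition lambda_alpha_G' :: "graph set \<Rightarrow> real \<Rightarrow> real \<Rightarrow> nat \<Rightarrow> real" where
  "lambda_alpha_G' \<F> \<epsilon> \<alpha> n = Max (lambda_alpha \<alpha> n ` G'_set \<F> \<epsilon> n)"

end

theory Submission
  imports Defs "HOL-Analysis.Function_Topology" "HOL-Analysis.Convex"
begin

text \<open>
  Let \<open>x\<close> be the nonnegative unit eigenvector of the largest eigenvalue \<open>\<mu>\<close> of a free graph with a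
  vertex of degree at most \<open>(\<pi> - \<epsilon>) n\<close>, and suppose that \<open>\<mu> \<ge> 2 ex(n) / n - \<sigma>\<close>. The eigenvalue
  equation at the vertex of low degree forces the smallest entry \<open>x\<^sub>w\<close> to satisfy
  \<open>n x\<^sub>w\<^sup>2 \<le> 1 - h\<close> with \<open>h = 6\<epsilon>/7\<close>, and testing the restriction of \<open>x\<close> shows that deleting \<open>w\<close> lowers
  the eigenvalue by at most about \<open>\<mu> / n - h\<^sup>2\<close>; in particular \<open>\<mu> / n\<close> grows by about \<open>h\<^sup>2 / n\<close>.
  The new eigenvalue exceeds \<open>2 ex(n - 1) / (n - 1) + \<sigma>\<close>: by \<open>h\<^sup>2 > \<epsilon>\<^sup>3 > 7\<sigma>\<close> if
  \<open>\<mu> / n \<le> \<pi> + 3\<sigma>/2\<close>, and by the growth of \<open>\<mu> / n\<close> otherwise. So the new graph again has a vertex of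
  low degree and the deletion can be repeated, until the divergence of the harmonic series contradicts
  \<open>\<mu> \<le> n\<close>. Of the Erdos--Stone--Simonovits theorem only
  the lower bound \<open>1 - 1/r \<le> \<pi> + \<sigma>\<close> is used, which follows from Turan graphs and the assumed growth
  of \<open>ex\<close>, whether or not the limit defining \<open>\<pi>\<close> exists.
\<close>

section \<open>Largest eigenvalues of symmetric nonnegative matrices\<close>

definition qform :: "nat \<Rightarrow> (nat \<Rightarrow> nat \<Rightarrow> real) \<Rightarrow> (nat \<Rightarrow> real) \<Rightarrow> real" where
  "qform n M x = (\<Sum>i<n. x i * (\<Sum>j<n. M i j * x j))"

lemma qform_cong: "(\<And>i. i < n \<Longrightarrow> x i = y i) \<Longrightarrow> qform n M x = qform n M y"
  unfolding qform_def by (intro sum.cong refl arg_cong2[of _ _ _ _ "(*)"]) auto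

lemma qform_scale: "qform n M (\<lambda>i. c * x i) = c\<^sup>2 * qform n M x"
  unfolding qform_def by (simp add: sum_distrib_left power2_eq_square mult_ac)

text \<open>Vectors are functions on all naturals, so the sphere is cut out by setting the
  coordinates from \<open>n\<close> on to zero. This closed set lies in a product of intervals
  \<open>{-1..1}\<close>, which is compact by Tychonoff.\<close>

lemma compact_unit_sphere:
  "compact {x :: nat \<Rightarrow> real. (\<forall>i\<ge>n. x i = 0) \<and> (\<Sum>i<n. (x i)\<^sup>2) = 1}" (is "compact ?K")
proof -
  let ?B = "PiE UNIV (\<lambda>_. {-1..1}) :: (nat \<Rightarrow> real) set"
  have "compactin (product_topology (\<lambda>_. euclidean) UNIV) ?B"
    by (subst compactin_PiE) auto
  hence B: "compact ?B" by (simp add: euclidean_product_topology)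
  have "closed {x :: nat \<Rightarrow> real. \<forall>i. i \<ge> n \<longrightarrow> x i = 0}"
    by (intro closed_Collect_all closed_Collect_imp closed_Collect_eq)
       (auto intro!: continuous_intros)
  moreover have "closed {x :: nat \<Rightarrow> real. (\<Sum>i<n. (x i)\<^sup>2) = 1}"
    by (intro closed_Collect_eq continuous_intros continuous_on_product_coordinates)
  ultimately have "closed ?K"
    by (auto simp: Collect_conj_eq)
  moreover have "x i \<in> {-1..1}" if x: "x \<in> ?K" for x i
  proof (cases "i < n")
    case True
    have "(x i)\<^sup>2 \<le> (\<Sum>i<n. (x i)\<^sup>2)"
      using True by (intro member_le_sum) auto
    with x show ?thesis by (auto simp: abs_square_le_1 abs_le_iff)
  qed (use x in auto)
  hence "?K \<subseteq> ?B" by auto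
  ultimately show ?thesis
    using compact_Int_closed[OF B, of ?K] by (simp only: Int_absorb1)
qed

text \<open>A continuous form attains its maximum on the compact unit sphere, and homogeneity of
  degree two carries the bound to every vector.\<close>

lemma rayleigh_maximizer:
  assumes "n > 0"
  obtains x where "(\<Sum>i<n. (x i)\<^sup>2) = 1"
    "\<And>y. qform n M y \<le> qform n M x * (\<Sum>i<n. (y i)\<^sup>2)"
proof -
  define K where "K = {x :: nat \<Rightarrow> real. (\<forall>i\<ge>n. x i = 0) \<and> (\<Sum>i<n. (x i)\<^sup>2) = 1}"
  have "(\<Sum>i<n. (if i = 0 then 1 else 0::real)\<^sup>2) = (\<Sum>i<n. if i = 0 then 1 else 0)"
    by (intro sum.cong) auto
  also have "\<dots> = 1" using assms by simp
  finally have "(\<lambda>i. if i = 0 then 1 else 0) \<in> K" using assms by (auto simp: K_def)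
  moreover have "continuous_on UNIV (qform n M)"
    unfolding qform_def by (intro continuous_intros continuous_on_product_coordinates)
  hence "continuous_on K (qform n M)" by (rule continuous_on_subset) (rule subset_UNIV)
  moreover have "compact K" unfolding K_def by (rule compact_unit_sphere)
  ultimately obtain x where x: "x \<in> K" "\<And>y. y \<in> K \<Longrightarrow> qform n M y \<le> qform n M x"
    using continuous_attains_sup[of K "qform n M"] by blast
  show thesis
  proof
    show "(\<Sum>i<n. (x i)\<^sup>2) = 1" using x(1) by (simp add: K_def)
    fix y :: "nat \<Rightarrow> real"
    let ?s = "\<Sum>i<n. (y i)\<^sup>2"
    show "qform n M y \<le> qform n M x * ?s"
    proof (cases "?s = 0")
      case True
      hence "y i = 0" if "i < n" for i
        using that by (simp add: sum_nonneg_eq_0_iff)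
      hence "qform n M y = 0" by (simp add: qform_def)
      thus ?thesis using True by simp
    next
      case False
      have s: "?s > 0" using False by (simp add: less_le sum_nonneg)
      define z where "z i = (if i < n then 1 / sqrt ?s * y i else 0)" for i
      have "(\<Sum>i<n. (z i)\<^sup>2) = (\<Sum>i<n. (y i)\<^sup>2 / ?s)"
        using s by (intro sum.cong) (auto simp: z_def power_divide power_mult_distrib)
      also have "\<dots> = 1" using s by (simp flip: sum_divide_distrib)
      finally have "z \<in> K" by (auto simp: z_def K_def)
      hence "qform n M z \<le> qform n M x" by (rule x(2))
      moreover have "qform n M z = qform n M (\<lambda>i. 1 / sqrt ?s * y i)"
        by (rule qform_cong) (simp add: z_def)
      hence "qform n M z = qform n M y / ?s"
        unfolding qform_scale using s by (simp add: power_divide)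
      ultimately show ?thesis using s by (simp add: divide_le_eq)
    qed
  qed
qed

text \<open>First-order condition of the variational argument: near 0 the linear term dominates
  unless its coefficient vanishes.\<close>

lemma linear_coeff_zero_of_nonneg:
  fixes a b :: real
  assumes "\<And>t. 0 \<le> 2 * t * a + t\<^sup>2 * b"
  shows "a = 0"
proof (rule ccontr)
  assume a: "a \<noteq> 0"
  \<comment> \<open>\<open>B\<close> is positive and exceeds \<open>b\<close>, so at
    \<open>t = - a / B\<close> the quadratic term cannot outweigh the linear one.\<close>
  define B where "B = \<bar>b\<bar> + 1"
  have B: "B > 0" "b < B" by (auto simp: B_def)
  have "0 \<le> (2 * (- a / B) * a + (- a / B)\<^sup>2 * b) * B\<^sup>2"
    using assms[of "- a / B"] by simp
  also have "\<dots> = a\<^sup>2 * (b - 2 * B)"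
    using B by (simp add: field_simps power2_eq_square)
  also have "\<dots> < 0" using a B by (intro mult_pos_neg) auto
  finally show False by simp
qed

text \<open>The residual \<open>z\<close> serves as the direction of perturbation. At
  \<open>x + t z\<close> the difference between the bound and the form has no constant term, by
  \<open>eq\<close>, and its linear coefficient is twice the squared norm of \<open>z\<close>, which
  therefore vanishes.\<close>

lemma maximizer_eigenvector:
  assumes sym: "\<And>i j. M i j = M j i"
    and max: "\<And>y. qform n M y \<le> \<mu> * (\<Sum>i<n. (y i)\<^sup>2)"
    and eq: "qform n M x = \<mu> * (\<Sum>i<n. (x i)\<^sup>2)"
    and "i < n"
  shows "(\<Sum>j<n. M i j * x j) = \<mu> * x i"
proof -
  define z where "z i = \<mu> * x i - (\<Sum>j<n. M i j * x j)" for i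
  have swap: "(\<Sum>i<n. x i * (\<Sum>j<n. M i j * z j)) = (\<Sum>i<n. z i * (\<Sum>j<n. M i j * x j))"
    unfolding sum_distrib_left by (subst sum.swap) (simp add: sym mult_ac)
  have "0 \<le> 2 * t * (\<Sum>i<n. (z i)\<^sup>2) + t\<^sup>2 * (\<mu> * (\<Sum>i<n. (z i)\<^sup>2) - qform n M z)" for t
  proof -
    have "qform n M (\<lambda>i. x i + t * z i) = qform n M x + t * (\<Sum>i<n. x i * (\<Sum>j<n. M i j * z j))
        + t * (\<Sum>i<n. z i * (\<Sum>j<n. M i j * x j)) + t\<^sup>2 * qform n M z"
      unfolding qform_def
      by (simp add: algebra_simps sum.distrib sum_distrib_left power2_eq_square)
    moreover have "(\<Sum>i<n. (x i + t * z i)\<^sup>2) =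
        (\<Sum>i<n. (x i)\<^sup>2) + 2 * t * (\<Sum>i<n. z i * x i) + t\<^sup>2 * (\<Sum>i<n. (z i)\<^sup>2)"
      by (simp add: power2_sum sum.distrib sum_distrib_left power_mult_distrib mult_ac)
    moreover have "(\<Sum>i<n. (z i)\<^sup>2) = \<mu> * (\<Sum>i<n. z i * x i) - (\<Sum>i<n. z i * (\<Sum>j<n. M i j * x j))"
      unfolding sum_distrib_left[of \<mu>] sum_subtractf[symmetric]
      by (intro sum.cong refl) (simp add: z_def power2_eq_square right_diff_distrib mult_ac)
    hence "2 * t * (\<Sum>i<n. (z i)\<^sup>2) =
        2 * t * (\<mu> * (\<Sum>i<n. z i * x i)) - 2 * t * (\<Sum>i<n. z i * (\<Sum>j<n. M i j * x j))"
      by (simp only: right_diff_distrib)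
    ultimately show ?thesis
      using max[of "\<lambda>i. x i + t * z i"] unfolding eq swap by (simp only: ring_distribs mult_ac)
  qed
  hence "(\<Sum>i<n. (z i)\<^sup>2) = 0" by (rule linear_coeff_zero_of_nonneg)
  thus ?thesis using \<open>i < n\<close> by (simp add: sum_nonneg_eq_0_iff z_def)
qed

text \<open>Replacing a maximizer by its absolute value does not decrease the form.\<close>

lemma nonneg_maximal_eigenvector:
  assumes "n > 0" and sym: "\<And>i j. M i j = M j i" and nonneg: "\<And>i j. M i j \<ge> 0"
  obtains x \<mu> where "\<And>i. x i \<ge> 0" "(\<Sum>i<n. (x i)\<^sup>2) = 1"
    "\<And>i. i < n \<Longrightarrow> (\<Sum>j<n. M i j * x j) = \<mu> * x i"
    "\<And>y. qform n M y \<le> \<mu> * (\<Sum>i<n. (y i)\<^sup>2)"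
proof -
  obtain x where x: "(\<Sum>i<n. (x i)\<^sup>2) = 1"
    "\<And>y. qform n M y \<le> qform n M x * (\<Sum>i<n. (y i)\<^sup>2)"
    using rayleigh_maximizer[OF \<open>n > 0\<close>] by blast
  have "x i * (M i j * x j) \<le> \<bar>x i\<bar> * (M i j * \<bar>x j\<bar>)" for i j
    using abs_ge_self[of "x i * (M i j * x j)"] nonneg[of i j] by (simp add: abs_mult)
  hence "qform n M x \<le> qform n M (\<lambda>i. \<bar>x i\<bar>)"
    unfolding qform_def sum_distrib_left by (intro sum_mono)
  moreover have "qform n M (\<lambda>i. \<bar>x i\<bar>) \<le> qform n M x"
    using x(2)[of "\<lambda>i. \<bar>x i\<bar>"] x(1) by simp
  ultimately have eq: "qform n M (\<lambda>i. \<bar>x i\<bar>) = qform n M x * (\<Sum>i<n. \<bar>x i\<bar>\<^sup>2)"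
    using x(1) by simp
  show thesis
    using that[of "\<lambda>i. \<bar>x i\<bar>" "qform n M x"] x maximizer_eigenvector[OF sym x(2) eq] by simp
qed

section \<open>Finiteness of the spectrum\<close>

text \<open>Bessel's inequality for the i-th standard unit vector bounds the sum of
  \<open>(u k i)\<^sup>2\<close> over \<open>S\<close> by 1; summing over the coordinates counts
  \<open>S\<close>.\<close>

lemma orthonormal_card_le:
  fixes u :: "'a \<Rightarrow> nat \<Rightarrow> real"
  assumes "finite S" and norm: "\<And>k. k \<in> S \<Longrightarrow> (\<Sum>i<n. (u k i)\<^sup>2) = 1"
    and orth: "\<And>k l. k \<in> S \<Longrightarrow> l \<in> S \<Longrightarrow> k \<noteq> l \<Longrightarrow> (\<Sum>i<n. u k i * u l i) = 0"
  shows "card S \<le> n"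
proof -
  have inner: "(\<Sum>i<n. u k i * u l i) = (if k = l then 1 else 0)" if "k \<in> S" "l \<in> S" for k l
    using that norm orth by (auto simp: power2_eq_square)
  have bessel: "(\<Sum>k\<in>S. (u k i)\<^sup>2) \<le> 1" if i: "i < n" for i
  proof -
    \<comment> \<open>\<open>?P\<close> is the orthogonal projection of the i-th unit vector onto
      the span of the family, so its squared norm equals its i-th coordinate.\<close>
    let ?P = "\<lambda>j. \<Sum>k\<in>S. u k i * u k j"
    have "(\<Sum>j<n. (?P j)\<^sup>2) = (\<Sum>j<n. \<Sum>k\<in>S. \<Sum>l\<in>S. u k i * u l i * (u k j * u l j))"
      by (simp add: power2_eq_square sum_product mult_ac)
    also have "\<dots> = (\<Sum>k\<in>S. \<Sum>l\<in>S. \<Sum>j<n. u k i * u l i * (u k j * u l j))"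
      by (subst sum.swap, intro sum.cong refl, subst sum.swap) simp
    also have "\<dots> = (\<Sum>k\<in>S. \<Sum>l\<in>S. u k i * u l i * (if k = l then 1 else 0))"
      by (intro sum.cong refl) (simp add: inner flip: sum_distrib_left)
    also have "\<dots> = ?P i"
      using \<open>finite S\<close> by (intro sum.cong refl) (simp add: if_distrib cong: if_cong)
    finally have P: "(\<Sum>j<n. (?P j)\<^sup>2) = ?P i" .
    have "0 \<le> (\<Sum>j<n. ((if j = i then 1 else 0) - ?P j)\<^sup>2)"
      by (intro sum_nonneg) simp
    also have "\<dots> = (\<Sum>j<n. if j = i then 1 else 0) - 2 * (\<Sum>j<n. if j = i then ?P j else 0)
        + (\<Sum>j<n. (?P j)\<^sup>2)"
      unfolding sum_distrib_left sum_subtractf[symmetric] sum.distrib[symmetric]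
      by (intro sum.cong refl) (simp add: power2_diff)
    also have "\<dots> = 1 - ?P i" using i P by simp
    finally show ?thesis by (simp add: power2_eq_square)
  qed
  have "real (card S) = (\<Sum>k\<in>S. \<Sum>i<n. (u k i)\<^sup>2)" using norm by simp
  also have "\<dots> = (\<Sum>i<n. \<Sum>k\<in>S. (u k i)\<^sup>2)" by (rule sum.swap)
  also have "\<dots> \<le> (\<Sum>i<n. 1)" using bessel by (intro sum_mono) auto
  finally show ?thesis by simp
qed

lemma eigenvectors_orthogonal:
  assumes sym: "\<And>i j. M i j = M j i" and "\<mu> \<noteq> \<nu>"
    and x: "\<And>i. i < n \<Longrightarrow> (\<Sum>j<n. M i j * x j) = \<mu> * x i"
    and y: "\<And>i. i < n \<Longrightarrow> (\<Sum>j<n. M i j * y j) = \<nu> * y i"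
  shows "(\<Sum>i<n. x i * y i) = (0 :: real)"
proof -
  have "\<nu> * (\<Sum>i<n. x i * y i) = (\<Sum>i<n. x i * (\<Sum>j<n. M i j * y j))"
    using y by (simp add: sum_distrib_left mult_ac)
  also have "\<dots> = (\<Sum>j<n. y j * (\<Sum>i<n. M j i * x i))"
    unfolding sum_distrib_left by (subst sum.swap) (simp add: sym mult_ac)
  also have "\<dots> = \<mu> * (\<Sum>i<n. x i * y i)"
    using x by (simp add: sum_distrib_left mult_ac)
  finally show ?thesis using \<open>\<mu> \<noteq> \<nu>\<close> by simp
qed

lemma unit_eigenvector:
  assumes "is_eigenvalue n M \<mu>"
  shows "\<exists>x. (\<Sum>i<n. (x i)\<^sup>2) = 1 \<and> (\<forall>i<n. (\<Sum>j<n. M i j * x j) = \<mu> * x i)"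
proof -
  obtain x k where x: "k < n" "x k \<noteq> 0" "\<And>i. i < n \<Longrightarrow> (\<Sum>j<n. M i j * x j) = \<mu> * x i"
    using assms unfolding is_eigenvalue_def by blast
  let ?s = "\<Sum>i<n. (x i)\<^sup>2"
  have s: "?s > 0" using x by (intro sum_pos2[of _ k]) auto
  have "(\<Sum>i<n. (x i / sqrt ?s)\<^sup>2) = 1"
    using s by (simp add: power_divide flip: sum_divide_distrib)
  moreover have "(\<Sum>j<n. M i j * (x j / sqrt ?s)) = \<mu> * (x i / sqrt ?s)" if "i < n" for i
    using x(3)[OF that] by (simp flip: sum_divide_distrib)
  ultimately show ?thesis by (intro exI[of _ "\<lambda>i. x i / sqrt ?s"]) simp
qed

text \<open>\<open>lambda_alpha\<close> is a \<open>Max\<close>, which is meaningful only on a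
  finite set. Eigenvectors of distinct eigenvalues are orthogonal, so there are at most
  \<open>n\<close> eigenvalues.\<close>

lemma finite_eigenvalues:
  assumes sym: "\<And>i j. M i j = M j i"
  shows "finite {\<mu>. is_eigenvalue n M \<mu>}"
proof (rule ccontr)
  assume "infinite {\<mu>. is_eigenvalue n M \<mu>}"
  then obtain S where S: "S \<subseteq> {\<mu>. is_eigenvalue n M \<mu>}" "finite S" "card S = Suc n"
    using infinite_arbitrarily_large by metis
  obtain u where u: "\<And>\<mu>. \<mu> \<in> S \<Longrightarrow> (\<Sum>i<n. (u \<mu> i)\<^sup>2) = 1"
    "\<And>\<mu> i. \<mu> \<in> S \<Longrightarrow> i < n \<Longrightarrow> (\<Sum>j<n. M i j * u \<mu> j) = \<mu> * u \<mu> i"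
    using S(1) unit_eigenvector[of n M] by (simp add: subset_iff) metis
  have "card S \<le> n"
  proof (rule orthonormal_card_le[OF S(2), where u = u])
    show "(\<Sum>i<n. u k i * u l i) = 0" if "k \<in> S" "l \<in> S" "k \<noteq> l" for k l
      by (rule eigenvectors_orthogonal[of M, OF sym \<open>k \<noteq> l\<close>]) (use u that in auto)
  qed (use u in auto)
  thus False using S(3) by simp
qed

section \<open>Vertex deletion\<close>

lemma is_graph_edgeD:
  assumes "is_graph n E" "{u, v} \<in> E"
  shows "u < n" "v < n" "u \<noteq> v"
  using assms unfolding is_graph_def by (force simp: doubleton_eq_iff)+

lemma finite_graphs: "finite {E. is_graph n E}"
proof (rule finite_subset)
  show "{E. is_graph n E} \<subseteq> Pow (Pow {..<n})" unfolding is_graph_def by force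
qed simp

lemma degree_eq_sum:
  assumes "is_graph n E"
  shows "real (degree E v) = (\<Sum>j<n. of_bool ({v, j} \<in> E))"
proof -
  have "{u. {u, v} \<in> E} = {j \<in> {..<n}. {v, j} \<in> E}"
    using is_graph_edgeD[OF assms] by (auto simp: insert_commute)
  moreover have "(\<Sum>j<n. of_bool ({v, j} \<in> E)) = (\<Sum>j\<in>{j \<in> {..<n}. {v, j} \<in> E}. 1 :: real)"
    by (intro sum.mono_neutral_cong_right) auto
  ultimately show ?thesis by (simp add: degree_def)
qed

lemma degree_le:
  assumes "is_graph n E"
  shows "degree E v \<le> n"
proof -
  have "{u. {u, v} \<in> E} \<subseteq> {..<n}" using is_graph_edgeD(1)[OF assms] by blast
  thus ?thesis using card_mono[of "{..<n}"] by (fastforce simp: degree_def)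
qed

section \<open>The form and the Perron vector of \<open>A_alpha\<close>\<close>

lemma A_alpha_row:
  assumes "is_graph n E" "i < n"
  shows "(\<Sum>j<n. A_alpha \<alpha> E i j * x j) =
    \<alpha> * degree E i * x i + (1 - \<alpha>) * (\<Sum>j<n. of_bool ({i, j} \<in> E) * x j)"
proof -
  have "(\<Sum>j<n. A_alpha \<alpha> E i j * x j) = (\<Sum>j<n. (if j = i then \<alpha> * degree E i * x i else 0)
      + (1 - \<alpha>) * (of_bool ({i, j} \<in> E) * x j))"
    by (intro sum.cong) (auto simp: A_alpha_def algebra_simps)
  also have "\<dots> = (\<Sum>j<n. if j = i then \<alpha> * degree E i * x i else 0)
      + (1 - \<alpha>) * (\<Sum>j<n. of_bool ({i, j} \<in> E) * x j)"
    by (simp only: sum.distrib sum_distrib_left)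
  finally show ?thesis using \<open>i < n\<close> by simp
qed

text \<open>Writing degrees as sums of edge indicators spreads the diagonal over ordered pairs of
  adjacent vertices. Deleting a vertex then amounts to dropping the pairs that contain it, which
  also accounts for the decrease of the other degrees.\<close>

lemma qform_A_alpha:
  assumes "is_graph n E"
  shows "qform n (A_alpha \<alpha> E) x =
    (\<Sum>i<n. \<Sum>j<n. of_bool ({i, j} \<in> E) * (\<alpha> * (x i)\<^sup>2 + (1 - \<alpha>) * x i * x j))"
  unfolding qform_def
proof (intro sum.cong refl)
  fix i assume "i \<in> {..<n}"
  define a :: "nat \<Rightarrow> real" where "a j = of_bool ({i, j} \<in> E)" for j
  have "x i * (\<Sum>j<n. A_alpha \<alpha> E i j * x j) =
    x i * (\<alpha> * (\<Sum>j<n. a j) * x i + (1 - \<alpha>) * (\<Sum>j<n. a j * x j))"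
    using \<open>i \<in> {..<n}\<close> assms by (simp only: A_alpha_row degree_eq_sum lessThan_iff a_def)
  also have "\<dots> = (\<Sum>j<n. a j * (\<alpha> * (x i)\<^sup>2 + (1 - \<alpha>) * x i * x j))"
    by (simp add: algebra_simps sum.distrib sum_subtractf sum_distrib_left power2_eq_square)
  finally show "x i * (\<Sum>j<n. A_alpha \<alpha> E i j * x j) =
    (\<Sum>j<n. of_bool ({i, j} \<in> E) * (\<alpha> * (x i)\<^sup>2 + (1 - \<alpha>) * x i * x j))" unfolding a_def .
qed

text \<open>Ties the spectral definition to the Rayleigh quotient: the maximum of the form on the
  unit sphere is itself an eigenvalue, and every eigenvalue is the value of the form at a unit
  eigenvector, hence no larger.\<close>

lemma lambda_alpha_perron:
  assumes "n > 0" "0 \<le> \<alpha>" "\<alpha> \<le> 1"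
  obtains x where "\<And>i. x i \<ge> 0" "(\<Sum>i<n. (x i)\<^sup>2) = 1"
    "\<And>i. i < n \<Longrightarrow> (\<Sum>j<n. A_alpha \<alpha> E i j * x j) = lambda_alpha \<alpha> n E * x i"
    "\<And>y. qform n (A_alpha \<alpha> E) y \<le> lambda_alpha \<alpha> n E * (\<Sum>i<n. (y i)\<^sup>2)"
proof -
  let ?M = "A_alpha \<alpha> E"
  have sym: "?M i j = ?M j i" for i j by (simp add: A_alpha_def insert_commute)
  have nonneg: "?M i j \<ge> 0" for i j using assms by (simp add: A_alpha_def)
  obtain x \<mu> where x: "\<And>i. x i \<ge> 0" "(\<Sum>i<n. (x i)\<^sup>2) = 1"
    "\<And>i. i < n \<Longrightarrow> (\<Sum>j<n. ?M i j * x j) = \<mu> * x i"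
    "\<And>y. qform n ?M y \<le> \<mu> * (\<Sum>i<n. (y i)\<^sup>2)"
    using nonneg_maximal_eigenvector[of n ?M, OF \<open>n > 0\<close> sym nonneg] by blast
  have "\<exists>i<n. x i \<noteq> 0"
  proof (rule ccontr)
    assume "\<not> (\<exists>i<n. x i \<noteq> 0)"
    hence "(\<Sum>i<n. (x i)\<^sup>2) = 0" by simp
    thus False using x(2) by simp
  qed
  hence ev: "is_eigenvalue n ?M \<mu>" using x(3) unfolding is_eigenvalue_def by blast
  have "lambda_alpha \<alpha> n E = \<mu>"
    unfolding lambda_alpha_def
  proof (rule Max_eqI)
    show "finite {\<mu>. is_eigenvalue n ?M \<mu>}" by (rule finite_eigenvalues[of ?M, OF sym])
    fix \<nu> assume "\<nu> \<in> {\<mu>. is_eigenvalue n ?M \<mu>}"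
    then obtain y where y: "(\<Sum>i<n. (y i)\<^sup>2) = 1" "\<And>i. i < n \<Longrightarrow> (\<Sum>j<n. ?M i j * y j) = \<nu> * y i"
      using unit_eigenvector[of n ?M \<nu>] by auto
    have "qform n ?M y = \<nu> * (\<Sum>i<n. (y i)\<^sup>2)"
      unfolding qform_def using y(2) by (simp add: sum_distrib_left power2_eq_square mult_ac)
    thus "\<nu> \<le> \<mu>" using x(4)[of y] y(1) by simp
  qed (use ev in simp)
  with x show thesis by (intro that[of x]) simp_all
qed

lemma qform_le_lambda_alpha:
  assumes "n > 0" "0 \<le> \<alpha>" "\<alpha> \<le> 1"
  shows "qform n (A_alpha \<alpha> E) y \<le> lambda_alpha \<alpha> n E * (\<Sum>i<n. (y i)\<^sup>2)"
proof -
  obtain x :: "nat \<Rightarrow> real"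
    where "\<And>y. qform n (A_alpha \<alpha> E) y \<le> lambda_alpha \<alpha> n E * (\<Sum>i<n. (y i)\<^sup>2)"
    by (rule lambda_alpha_perron[OF assms, of E]) (rule that)
  thus ?thesis .
qed

text \<open>In the eigenvalue equation at a largest entry of the Perron vector, every neighbour's
  entry is at most that one, so the eigenvalue is at most the degree of that vertex.\<close>

lemma lambda_alpha_le:
  assumes "is_graph n E" "n > 0" "0 \<le> \<alpha>" "\<alpha> \<le> 1"
  shows "lambda_alpha \<alpha> n E \<le> n"
proof -
  obtain x where x: "\<And>i. x i \<ge> 0" "(\<Sum>i<n. (x i)\<^sup>2) = 1"
    "\<And>i. i < n \<Longrightarrow> (\<Sum>j<n. A_alpha \<alpha> E i j * x j) = lambda_alpha \<alpha> n E * x i"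
    by (rule lambda_alpha_perron[OF assms(2-4), of E]) (rule that)
  have "Max (x ` {..<n}) \<in> x ` {..<n}" using \<open>n > 0\<close> by (intro Max_in) auto
  then obtain i where i: "i < n" "Max (x ` {..<n}) = x i" by auto
  have max: "x j \<le> x i" if "j < n" for j
    unfolding i(2)[symmetric] using that by simp
  have "x i \<noteq> 0"
  proof
    assume "x i = 0"
    hence "x j = 0" if "j < n" for j using max[OF that] x(1)[of j] by simp
    thus False using x(2) by simp
  qed
  hence pos: "x i > 0" using x(1)[of i] by simp
  have "lambda_alpha \<alpha> n E * x i =
      \<alpha> * degree E i * x i + (1 - \<alpha>) * (\<Sum>j<n. of_bool ({i, j} \<in> E) * x j)"
    using x(3)[OF i(1)] A_alpha_row[OF assms(1) i(1)] by simp
  also have "\<dots> \<le> \<alpha> * degree E i * x i + (1 - \<alpha>) * (\<Sum>j<n. of_bool ({i, j} \<in> E) * x i)"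
    using max assms by (intro add_left_mono mult_left_mono sum_mono) auto
  also have "\<dots> = degree E i * x i"
    by (simp add: degree_eq_sum[OF assms(1)] algebra_simps flip: sum_distrib_right)
  also have "\<dots> \<le> n * x i"
    using degree_le[OF assms(1), of i] pos by (intro mult_right_mono) auto
  finally show ?thesis using pos by simp
qed

section \<open>Effect of a deletion on the largest eigenvalue\<close>

text \<open>Graphs live on initial segments, so the remaining vertices are relabelled by a bijection
  \<open>g\<close>. The last conclusion transports test vectors along \<open>g\<close>, with
  \<open>y = x \<circ> g\<close>, without exposing \<open>g\<close>.\<close>

lemma delete_vertex:
  assumes "is_graph n E" "w < n"
  obtains E' where "is_graph (n - 1) E'" "\<And>F. free F (n, E) \<Longrightarrow> free F (n - 1, E')"
    "\<And>x. \<exists>y. (\<Sum>i<n-1. (y i)\<^sup>2) = (\<Sum>i\<in>{..<n}-{w}. (x i)\<^sup>2) \<and>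
       qform (n - 1) (A_alpha \<alpha> E') y = (\<Sum>i\<in>{..<n}-{w}. \<Sum>j\<in>{..<n}-{w}.
         of_bool ({i, j} \<in> E) * (\<alpha> * (x i)\<^sup>2 + (1 - \<alpha>) * x i * x j))"
proof -
  obtain g where g: "bij_betw g {..<n-1} ({..<n}-{w})"
    using finite_same_card_bij[of "{..<n-1}" "{..<n}-{w}"] \<open>w < n\<close> by auto
  define E' where "E' = {{u, v} | u v. u < n - 1 \<and> v < n - 1 \<and> {g u, g v} \<in> E}"
  have E': "{i, j} \<in> E' \<longleftrightarrow> {g i, g j} \<in> E" if "i < n - 1" "j < n - 1" for i j
    using that by (auto simp: E'_def doubleton_eq_iff insert_commute)
  have graph: "is_graph (n - 1) E'"
    using is_graph_edgeD(3)[OF assms(1)] unfolding is_graph_def E'_def by fast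
  have free: "free F (n - 1, E')" if "free F (n, E)" for F
    unfolding free_def
  proof (intro ballI notI)
    fix H assume "H \<in> F" and "contains (n - 1, E') H"
    then obtain f where f: "inj_on f {..<fst H}" "f ` {..<fst H} \<subseteq> {..<n-1}"
      "\<And>e. e \<in> snd H \<Longrightarrow> f ` e \<in> E'"
      unfolding contains_def by auto
    have "inj_on (g \<circ> f) {..<fst H}"
      using f(1,2) g by (meson bij_betw_imp_inj_on comp_inj_on inj_on_subset)
    moreover have "(g \<circ> f) ` {..<fst H} \<subseteq> {..<n}"
      using f(2) bij_betw_imp_surj_on[OF g] by fastforce
    moreover have "(g \<circ> f) ` e \<in> E" if e: "e \<in> snd H" for e
    proof -
      obtain u v where "f ` e = {u, v}" "{g u, g v} \<in> E"
        using f(3)[OF e] by (auto simp: E'_def)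
      thus ?thesis unfolding image_comp[symmetric] by simp
    qed
    ultimately have "contains (n, E) H"
      unfolding contains_def by (intro exI[of _ "g \<circ> f"]) simp
    thus False using \<open>free F (n, E)\<close> \<open>H \<in> F\<close> by (auto simp: free_def)
  qed
  have form: "\<exists>y. (\<Sum>i<n-1. (y i)\<^sup>2) = (\<Sum>i\<in>{..<n}-{w}. (x i)\<^sup>2) \<and>
       qform (n - 1) (A_alpha \<alpha> E') y = (\<Sum>i\<in>{..<n}-{w}. \<Sum>j\<in>{..<n}-{w}.
         of_bool ({i, j} \<in> E) * (\<alpha> * (x i)\<^sup>2 + (1 - \<alpha>) * x i * x j))" for x
    unfolding qform_A_alpha[OF graph] sum.reindex_bij_betw[OF g, symmetric]
    using E' by (intro exI[of _ "x \<circ> g"] conjI sum.cong refl) auto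
  show thesis by (rule that[OF graph]) (rule free, assumption, rule form)
qed

text \<open>The restriction of \<open>x\<close> to the other vertices is the test vector. The form
  loses the row and the column of \<open>w\<close>; the eigenvalue equation at \<open>w\<close>
  evaluates the adjacency part of both, and the squares over the neighbours are bounded because the
  non-neighbours take their share of the unit norm.\<close>

lemma lambda_alpha_delete:
  fixes x :: "nat \<Rightarrow> real" and \<alpha> \<mu> :: real
  assumes graph: "is_graph n E" and "w < n" "0 \<le> \<alpha>" "\<alpha> \<le> 1"
    and x: "\<And>i. x i \<ge> 0" "(\<Sum>i<n. (x i)\<^sup>2) = 1"
      "\<And>i. i < n \<Longrightarrow> (\<Sum>j<n. A_alpha \<alpha> E i j * x j) = \<mu> * x i"
    and min: "\<And>j. j < n \<Longrightarrow> x w \<le> x j"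
    and "n \<ge> 2"
  obtains E' where "is_graph (n - 1) E'" "\<And>F. free F (n, E) \<Longrightarrow> free F (n - 1, E')"
    "\<mu> * (1 - 2 * (x w)\<^sup>2) - \<alpha> * (1 - n * (x w)\<^sup>2) \<le> lambda_alpha \<alpha> (n - 1) E' * (1 - (x w)\<^sup>2)"
proof -
  define a :: "nat \<Rightarrow> nat \<Rightarrow> real" where "a i j = of_bool ({i, j} \<in> E)" for i j
  have a_sym: "a i j = a j i" and a_le: "a i j \<le> 1" for i j
    by (simp_all add: a_def insert_commute)
  let ?f = "\<lambda>i j. a i j * (\<alpha> * (x i)\<^sup>2 + (1 - \<alpha>) * x i * x j)"
  let ?V = "{..<n} - {w}" let ?d = "real (degree E w)"
  define S where "S = (\<Sum>j<n. a w j * x j)"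
  define T where "T = (\<Sum>j<n. a w j * (x j)\<^sup>2)"
  obtain E' where E': "is_graph (n - 1) E'" "\<And>F. free F (n, E) \<Longrightarrow> free F (n - 1, E')"
    and ex: "\<And>z. \<exists>y. (\<Sum>i<n-1. (y i)\<^sup>2) = (\<Sum>i\<in>?V. (z i)\<^sup>2) \<and>
       qform (n - 1) (A_alpha \<alpha> E') y =
         (\<Sum>i\<in>?V. \<Sum>j\<in>?V. of_bool ({i, j} \<in> E) * (\<alpha> * (z i)\<^sup>2 + (1 - \<alpha>) * z i * z j))"
    by (rule delete_vertex[OF graph \<open>w < n\<close>, of \<alpha>]) (rule that)
  obtain y where y: "(\<Sum>i<n-1. (y i)\<^sup>2) = (\<Sum>i\<in>?V. (x i)\<^sup>2)"
       "qform (n - 1) (A_alpha \<alpha> E') y = (\<Sum>i\<in>?V. \<Sum>j\<in>?V. ?f i j)"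
    using ex[of x] by (elim exE conjE) (rule that, assumption, simp only: a_def)
  \<comment> \<open>No loop at \<open>w\<close>: the index \<open>w\<close> can be added to the
    column sum below at no cost.\<close>
  have aww: "a w w = 0" using is_graph_edgeD(3)[OF graph, of w w] by (auto simp: a_def)
  have deg: "?d = (\<Sum>j<n. a w j)" unfolding a_def by (rule degree_eq_sum[OF graph])
  have muS: "(1 - \<alpha>) * S = (\<mu> - \<alpha> * ?d) * x w"
    using x(3)[OF \<open>w < n\<close>] A_alpha_row[OF graph \<open>w < n\<close>, of \<alpha> x] by (simp add: S_def a_def algebra_simps)
  have "\<mu> = qform n (A_alpha \<alpha> E) x"
  proof -
    have "qform n (A_alpha \<alpha> E) x = (\<Sum>i<n. \<mu> * (x i)\<^sup>2)"
      unfolding qform_def by (intro sum.cong refl) (simp add: x(3) power2_eq_square)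
    thus ?thesis using x(2) by (simp flip: sum_distrib_left)
  qed
  also have "\<dots> = (\<Sum>i<n. \<Sum>j<n. ?f i j)" unfolding a_def by (rule qform_A_alpha[OF graph])
  also have "\<dots> = (\<Sum>j<n. ?f w j) + (\<Sum>i\<in>?V. \<Sum>j<n. ?f i j)"
    using \<open>w < n\<close> by (simp add: sum.remove[of "{..<n}" w])
  also have "(\<Sum>i\<in>?V. \<Sum>j<n. ?f i j) = (\<Sum>i\<in>?V. ?f i w) + (\<Sum>i\<in>?V. \<Sum>j\<in>?V. ?f i j)"
    using \<open>w < n\<close> by (simp add: sum.remove[of "{..<n}" w] sum.distrib)
  also have "(\<Sum>i\<in>?V. ?f i w) = (\<Sum>i<n. ?f i w)"
    using \<open>w < n\<close> aww by (simp add: sum.remove[of "{..<n}" w "\<lambda>i. ?f i w"])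
  also have "\<dots> = \<alpha> * T + (1 - \<alpha>) * S * x w"
    unfolding S_def T_def
    by (simp add: algebra_simps sum.distrib sum_subtractf sum_distrib_left a_sym[of w])
  also have "(\<Sum>j<n. ?f w j) = \<alpha> * (x w)\<^sup>2 * ?d + (1 - \<alpha>) * S * x w"
    unfolding S_def deg
    by (simp add: algebra_simps sum.distrib sum_subtractf sum_distrib_left power2_eq_square)
  finally have 1: "\<mu> = 2 * \<mu> * (x w)\<^sup>2 - \<alpha> * ?d * (x w)\<^sup>2 + \<alpha> * T + (\<Sum>i\<in>?V. \<Sum>j\<in>?V. ?f i j)"
    unfolding muS by (simp add: power2_eq_square algebra_simps)
  \<comment> \<open>The \<open>n - ?d\<close> vertices not adjacent to \<open>w\<close>, including
    \<open>w\<close> itself, each contribute at least \<open>(x w)\<^sup>2\<close> to the unit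
    norm.\<close>
  have T: "T \<le> 1 - (n - ?d) * (x w)\<^sup>2"
  proof -
    have "(n - ?d) * (x w)\<^sup>2 = (\<Sum>j<n. (1 - a w j) * (x w)\<^sup>2)"
      by (simp add: deg sum_subtractf flip: sum_distrib_right)
    also have "\<dots> \<le> (\<Sum>j<n. (1 - a w j) * (x j)\<^sup>2)"
      using x(1) min a_le by (intro sum_mono mult_left_mono power_mono) auto
    also have "\<dots> = 1 - T" using x(2) by (simp add: T_def left_diff_distrib sum_subtractf)
    finally show ?thesis by simp
  qed
  have "(\<Sum>i\<in>?V. (x i)\<^sup>2) = 1 - (x w)\<^sup>2"
    using \<open>w < n\<close> x(2) by (simp add: sum.remove[of "{..<n}" w])
  hence form: "(\<Sum>i\<in>?V. \<Sum>j\<in>?V. ?f i j) \<le> lambda_alpha \<alpha> (n - 1) E' * (1 - (x w)\<^sup>2)"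
    using qform_le_lambda_alpha[OF _ \<open>0 \<le> \<alpha>\<close> \<open>\<alpha> \<le> 1\<close>, of "n - 1" E' y, unfolded y] \<open>n \<ge> 2\<close> by simp
  have loss: "\<alpha> * T \<le> \<alpha> * (1 - (n - ?d) * (x w)\<^sup>2)"
    using T \<open>0 \<le> \<alpha>\<close> by (rule mult_left_mono)
  \<comment> \<open>The degree of \<open>w\<close> cancels: it enters with opposite signs through
    the identity for \<mu> and through the bound on \<open>T\<close>.\<close>
  have arith: "\<mu> * (1 - 2 * p) - \<alpha> * (1 - m * p) \<le> R"
    if "\<mu> = 2 * \<mu> * p - \<alpha> * d * p + \<alpha> * T + Q" "Q \<le> R" "\<alpha> * T \<le> \<alpha> * (1 - (m - d) * p)"
    for p d T Q R m :: real
  proof -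
    have "\<alpha> * (1 - (m - d) * p) = \<alpha> - \<alpha> * m * p + \<alpha> * d * p"
      by (simp add: algebra_simps)
    moreover have "\<mu> * (1 - 2 * p) = \<mu> - 2 * \<mu> * p" by (simp add: algebra_simps)
    moreover have "\<alpha> * (1 - m * p) = \<alpha> - \<alpha> * m * p" by (simp add: algebra_simps)
    ultimately show ?thesis using that by linarith
  qed
  from arith[OF 1 form loss] have "\<mu> * (1 - 2 * (x w)\<^sup>2) - \<alpha> * (1 - n * (x w)\<^sup>2)
      \<le> lambda_alpha \<alpha> (n - 1) E' * (1 - (x w)\<^sup>2)" .
  thus thesis by (intro that[OF E'(1)]) (rule E'(2))
qed

text \<open>The equation at \<open>u\<close>, with \<open>x u\<close> bounded below by
  \<open>x w\<close>, is combined with Cauchy-Schwarz over the neighbours of \<open>u\<close>. The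
  non-neighbours of \<open>u\<close> take at least \<open>(n - degree E u) * (x w)\<^sup>2\<close>
  of the unit norm.\<close>

lemma min_entry_bound:
  fixes x :: "nat \<Rightarrow> real" and \<alpha> \<mu> :: real
  assumes graph: "is_graph n E" and "w < n" "u < n" "0 \<le> \<alpha>" "\<alpha> \<le> 1"
    and x: "\<And>i. x i \<ge> 0" "(\<Sum>i<n. (x i)\<^sup>2) = 1"
      "\<And>i. i < n \<Longrightarrow> (\<Sum>j<n. A_alpha \<alpha> E i j * x j) = \<mu> * x i"
    and min: "\<And>j. j < n \<Longrightarrow> x w \<le> x j"
    and le: "\<alpha> * degree E u \<le> \<mu>"
  shows "(\<mu> - \<alpha> * degree E u)\<^sup>2 * (x w)\<^sup>2
    \<le> (1 - \<alpha>)\<^sup>2 * degree E u * (1 - (n - real (degree E u)) * (x w)\<^sup>2)"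
proof -
  define a :: "nat \<Rightarrow> real" where "a j = of_bool ({u, j} \<in> E)" for j
  have a: "a j \<le> 1" "a j * a j = a j" for j by (simp_all add: a_def)
  let ?d = "real (degree E u)"
  have deg: "?d = (\<Sum>j<n. a j)" unfolding a_def by (rule degree_eq_sum[OF graph])
  have "(n - ?d) * (x w)\<^sup>2 = (\<Sum>j<n. (1 - a j) * (x w)\<^sup>2)"
    by (simp add: deg sum_subtractf flip: sum_distrib_right)
  also have "\<dots> \<le> (\<Sum>j<n. (1 - a j) * (x j)\<^sup>2)"
    using x(1) min a by (intro sum_mono mult_left_mono power_mono) auto
  also have "\<dots> = 1 - (\<Sum>j<n. a j * (x j)\<^sup>2)"
    using x(2) by (simp add: left_diff_distrib sum_subtractf)
  finally have T: "(\<Sum>j<n. a j * (x j)\<^sup>2) \<le> 1 - (n - ?d) * (x w)\<^sup>2" by simp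
  have "(\<mu> - \<alpha> * ?d) * x u = (1 - \<alpha>) * (\<Sum>j<n. a j * x j)"
    using x(3)[OF \<open>u < n\<close>] A_alpha_row[OF graph \<open>u < n\<close>, of \<alpha> x] by (simp add: a_def algebra_simps)
  moreover have "(\<mu> - \<alpha> * ?d) * x w \<le> (\<mu> - \<alpha> * ?d) * x u"
    using le min[OF \<open>u < n\<close>] by (intro mult_left_mono) auto
  ultimately have "((\<mu> - \<alpha> * ?d) * x w)\<^sup>2 \<le> ((1 - \<alpha>) * (\<Sum>j<n. a j * x j))\<^sup>2"
    using le x(1)[of w] by (intro power_mono) auto
  \<comment> \<open>Indicators are idempotent; the extra factor makes Cauchy-Schwarz produce the
    degree rather than \<open>n\<close>.\<close>
  also have "\<dots> = (1 - \<alpha>)\<^sup>2 * (\<Sum>j<n. a j * (a j * x j))\<^sup>2"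
    by (simp add: power_mult_distrib a mult.assoc[symmetric])
  also have "\<dots> \<le> (1 - \<alpha>)\<^sup>2 * ((\<Sum>j<n. (a j)\<^sup>2) * (\<Sum>j<n. (a j * x j)\<^sup>2))"
    by (intro mult_left_mono Cauchy_Schwarz_ineq_sum) simp
  also have "\<dots> = (1 - \<alpha>)\<^sup>2 * (?d * (\<Sum>j<n. a j * (x j)\<^sup>2))"
    by (simp add: deg power_mult_distrib a power2_eq_square[of "a _"])
  also have "\<dots> \<le> (1 - \<alpha>)\<^sup>2 * (?d * (1 - (n - ?d) * (x w)\<^sup>2))"
    using T by (intro mult_left_mono) auto
  finally show ?thesis by (simp add: power_mult_distrib mult_ac)
qed

text \<open>Here \<open>d\<close>, \<open>L\<close> and \<open>s\<close> stand for the degree over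
  \<open>n\<close>, the eigenvalue over \<open>n\<close>, and \<open>n\<close> times the smallest
  squared entry. With \<open>b = 1 - \<alpha>\<close> the terms
  \<open>b\<^sup>2 * d\<^sup>2 * s\<close> cancel. If \<open>1 - s < h\<close>, the right side is at
  most \<open>b * d * h\<close>, while \<open>s \<ge> 1/2\<close> makes the left side at least
  \<open>b * d * h + h\<^sup>2 / 2\<close>.\<close>

lemma min_entry_weight_le:
  fixes \<alpha> d h L s :: real
  assumes "0 \<le> \<alpha>" "\<alpha> \<le> 1" "0 \<le> d" "0 < h" "h \<le> 1/2" "d + h \<le> L" "0 \<le> s" "s \<le> 1"
    and le: "(L - \<alpha> * d)\<^sup>2 * s \<le> (1 - \<alpha>)\<^sup>2 * d * (1 - (1 - d) * s)"
  shows "s \<le> 1 - h"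
proof (rule ccontr)
  assume "\<not> s \<le> 1 - h"
  hence s: "1 - s < h" "s \<ge> 1/2" using assms by auto
  define b where "b = 1 - \<alpha>"
  have b: "0 \<le> b" "b \<le> 1" using assms by (auto simp: b_def)
  have "b * d \<ge> 0" using b assms by simp
  moreover have "b * d + h \<le> L - \<alpha> * d" using assms by (simp add: b_def algebra_simps)
  ultimately have "(b * d + h)\<^sup>2 \<le> (L - \<alpha> * d)\<^sup>2"
    using assms by (intro power_mono) auto
  hence "(b * d + h)\<^sup>2 * s \<le> b\<^sup>2 * d * (1 - (1 - d) * s)"
    using le assms mult_right_mono[of "(b * d + h)\<^sup>2" "(L - \<alpha> * d)\<^sup>2" s] by (simp add: b_def)
  hence "(2 * b * d * h + h\<^sup>2) * s \<le> b * (b * d * (1 - s))"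
    by (simp add: power2_eq_square algebra_simps)
  also have "\<dots> \<le> 1 * (b * d * (1 - s))"
    using b assms by (intro mult_right_mono) auto
  also have "\<dots> \<le> b * d * h"
    using b assms s by (simp add: mult_left_mono)
  finally have "(2 * b * d * h + h\<^sup>2) * s \<le> b * d * h" .
  moreover have "(2 * b * d * h + h\<^sup>2) * (1/2) \<le> (2 * b * d * h + h\<^sup>2) * s"
    using s b assms by (intro mult_left_mono) auto
  moreover have "h\<^sup>2 > 0" using assms by simp
  ultimately show False by simp
qed

text \<open>The vertex \<open>u\<close> of low degree only serves to force
  \<open>1 - s \<ge> h\<close>; the deleted vertex is \<open>w\<close>, the one with the smallest
  entry. The gain is the share \<open>1 - s\<close> of \<open>\<mu> - \<alpha> * n\<close>.\<close>

lemma descent_step: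
  fixes \<alpha> h :: real
  assumes graph: "is_graph n E" and "n \<ge> 2" "0 \<le> \<alpha>" "\<alpha> \<le> 1" "0 < h" "h \<le> 1/2"
    and u: "u < n" "degree E u + h * n \<le> lambda_alpha \<alpha> n E"
    and \<alpha>: "\<alpha> * n \<le> lambda_alpha \<alpha> n E"
  obtains E' where "is_graph (n - 1) E'" "\<And>F. free F (n, E) \<Longrightarrow> free F (n - 1, E')"
    "(real n - 2) * lambda_alpha \<alpha> n E + h * (lambda_alpha \<alpha> n E - \<alpha> * n)
       \<le> (real n - 1) * lambda_alpha \<alpha> (n - 1) E'"
proof -
  define \<mu> where "\<mu> = lambda_alpha \<alpha> n E"
  have "n > 0" using \<open>n \<ge> 2\<close> by simp
  obtain x where x: "\<And>i. x i \<ge> 0" "(\<Sum>i<n. (x i)\<^sup>2) = 1"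
    "\<And>i. i < n \<Longrightarrow> (\<Sum>j<n. A_alpha \<alpha> E i j * x j) = \<mu> * x i"
    by (rule lambda_alpha_perron[OF \<open>n > 0\<close> \<open>0 \<le> \<alpha>\<close> \<open>\<alpha> \<le> 1\<close>, of E, folded \<mu>_def]) (rule that)
  have "Min (x ` {..<n}) \<in> x ` {..<n}" using \<open>n > 0\<close> by (intro Min_in) auto
  then obtain w where w: "w < n" "Min (x ` {..<n}) = x w" by auto
  have min: "x w \<le> x j" if "j < n" for j
    unfolding w(2)[symmetric] using that by simp
  define s where "s = n * (x w)\<^sup>2"
  have p: "(x w)\<^sup>2 = s / n" using \<open>n > 0\<close> by (simp add: s_def)
  have "(\<Sum>j<n. (x w)\<^sup>2) \<le> (\<Sum>j<n. (x j)\<^sup>2)"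
    using x(1) min by (intro sum_mono power_mono) auto
  hence s: "0 \<le> s" "s \<le> 1" using x(2) by (simp_all add: s_def)
  have "\<alpha> * degree E u \<le> 1 * real (degree E u)" using \<open>\<alpha> \<le> 1\<close> by (intro mult_right_mono) auto
  hence "\<alpha> * degree E u \<le> \<mu>" using u(2) \<open>0 < h\<close> \<open>n > 0\<close> 
    by (simp add: \<mu>_def) (smt (verit) mult_nonneg_nonneg of_nat_0_le_iff)
  have "(\<mu> - \<alpha> * degree E u)\<^sup>2 * (s / n)
      \<le> (1 - \<alpha>)\<^sup>2 * degree E u * (1 - (n - real (degree E u)) * (s / n))"
    unfolding p[symmetric]
    by (rule min_entry_bound[OF graph w(1) u(1) \<open>0 \<le> \<alpha>\<close> \<open>\<alpha> \<le> 1\<close> x min \<open>\<alpha> * degree E u \<le> \<mu>\<close>])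
  from divide_right_mono[OF this, of "real n"]
  have "(\<mu> / n - \<alpha> * (degree E u / n))\<^sup>2 * s
      \<le> (1 - \<alpha>)\<^sup>2 * (degree E u / n) * (1 - (1 - degree E u / n) * s)"
    using \<open>n > 0\<close> by (simp add: field_simps power2_eq_square)
  moreover have "(degree E u + h * n) / n \<le> \<mu> / n"
    using u(2) unfolding \<mu>_def by (rule divide_right_mono) simp
  hence "degree E u / n + h \<le> \<mu> / n" using \<open>n > 0\<close> by (simp add: add_divide_distrib)
  ultimately have sh: "s \<le> 1 - h"
    using assms(3-6) s by (intro min_entry_weight_le[of \<alpha> "degree E u / n" h "\<mu> / n" s]) simp_all
  obtain E' where E': "is_graph (n - 1) E'" "\<And>F. free F (n, E) \<Longrightarrow> free F (n - 1, E')"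
    and le: "\<mu> * (1 - 2 * (x w)\<^sup>2) - \<alpha> * (1 - n * (x w)\<^sup>2)
      \<le> lambda_alpha \<alpha> (n - 1) E' * (1 - (x w)\<^sup>2)"
    by (rule lambda_alpha_delete[OF graph w(1) \<open>0 \<le> \<alpha>\<close> \<open>\<alpha> \<le> 1\<close> x min \<open>n \<ge> 2\<close>]) (assumption, assumption, rule that)
  define \<nu> where "\<nu> = lambda_alpha \<alpha> (n - 1) E'"
  have "\<mu> * (1 - 2 * s / n) - \<alpha> * (1 - s) \<le> \<nu> * (1 - s / n)"
    using le \<open>n > 0\<close> by (simp add: p \<nu>_def)
  hence *: "n * (\<mu> * (1 - 2 * s / n) - \<alpha> * (1 - s)) \<le> n * (\<nu> * (1 - s / n))"
    by (rule mult_left_mono) simp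
  hence loss: "(n - s) * (\<mu> - \<nu>) \<le> \<mu> * s + \<alpha> * n * (1 - s)"
  proof -
    have "n * (\<mu> * (1 - 2 * s / n) - \<alpha> * (1 - s)) = \<mu> * (n - 2 * s) - \<alpha> * n * (1 - s)"
      "n * (\<nu> * (1 - s / n)) = \<nu> * (n - s)"
      using \<open>n > 0\<close> by (simp_all add: right_diff_distrib)
    thus ?thesis using * by (simp add: algebra_simps)
  qed
  have "0 \<le> \<alpha> * n" using assms by simp
  hence "0 \<le> \<mu>" using \<alpha> by (simp add: \<mu>_def)
  \<comment> \<open>Since \<open>s \<le> 1\<close>, the factor \<open>n - s\<close> may be lowered
    to \<open>n - 1\<close> when \<open>\<nu> \<le> \<mu>\<close>; otherwise the left side is
    nonpositive and the right side nonnegative.\<close>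
  have "(real n - 1) * (\<mu> - \<nu>) \<le> \<mu> * s + \<alpha> * n * (1 - s)"
  proof (cases "\<nu> \<le> \<mu>")
    case True
    hence "(real n - 1) * (\<mu> - \<nu>) \<le> (n - s) * (\<mu> - \<nu>)"
      using s by (intro mult_right_mono) auto
    thus ?thesis using loss by simp
  next
    case False
    hence "(real n - 1) * (\<mu> - \<nu>) \<le> 0" using \<open>n \<ge> 2\<close> by (intro mult_nonneg_nonpos) auto
    moreover have "0 \<le> \<mu> * s + \<alpha> * n * (1 - s)" using s \<open>0 \<le> \<mu>\<close> \<open>0 \<le> \<alpha>\<close> by simp
    ultimately show ?thesis by simp
  qed
  also have "\<dots> = \<mu> - (1 - s) * (\<mu> - \<alpha> * n)" by (simp add: algebra_simps)
  also have "\<dots> \<le> \<mu> - h * (\<mu> - \<alpha> * n)"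
    using sh \<alpha> by (simp add: \<mu>_def mult_right_mono)
  finally have "(real n - 2) * \<mu> + h * (\<mu> - \<alpha> * n) \<le> (real n - 1) * \<nu>"
    using \<open>n \<ge> 2\<close> by (simp add: of_nat_diff algebra_simps)
  thus thesis unfolding \<mu>_def \<nu>_def by (intro that[OF E'(1)]) (rule E'(2))
qed

section \<open>Growth of the extremal function\<close>

text \<open>The differences telescope from \<open>N\<close>. \<open>D\<close> keeps the starting
  error, and replacing \<open>n * (n + 1)\<close> by a square leaves a linear error, collected in
  \<open>C\<close>.\<close>

lemma quadratic_growth:
  fixes f :: "nat \<Rightarrow> real" and t \<sigma> :: real
  assumes diff: "\<And>n. n > N \<Longrightarrow> \<bar>f n - f (n - 1) - t * n\<bar> \<le> \<sigma> * n" and "\<sigma> \<ge> 0"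
  obtains C :: real where "C \<ge> 0" "\<And>n. n \<ge> N \<Longrightarrow> n > 0 \<Longrightarrow> \<bar>2 * f n - t * (real n)\<^sup>2\<bar> \<le> \<sigma> * (real n)\<^sup>2 + C * real n"
proof -
  define D where "D = \<bar>2 * f N - t * (N * (N + 1))\<bar>"
  have ind: "\<bar>2 * f n - t * (n * (n + 1))\<bar> \<le> \<sigma> * (n * (n + 1)) + D" if "n \<ge> N" for n
    using that
  proof (induction n rule: dec_induct)
    case base
    show ?case using \<open>\<sigma> \<ge> 0\<close> by (simp add: D_def)
  next
    case (step n)
    have "\<bar>2 * (f (Suc n) - f n - t * Suc n)\<bar> \<le> 2 * (\<sigma> * Suc n)"
      using diff[of "Suc n"] step.hyps by (simp del: of_nat_Suc)
    moreover have "2 * f (Suc n) - t * (Suc n * (Suc n + 1)) =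
        2 * (f (Suc n) - f n - t * Suc n) + (2 * f n - t * (n * (n + 1)))"
      by (simp add: algebra_simps)
    moreover have "\<sigma> * (Suc n * (Suc n + 1)) = 2 * (\<sigma> * Suc n) + \<sigma> * (n * (n + 1))"
      by (simp add: algebra_simps)
    ultimately show ?case using step.IH by linarith
  qed
  show thesis
  proof (rule that[of "\<bar>t\<bar> + \<sigma> + D"])
    show "0 \<le> \<bar>t\<bar> + \<sigma> + D" using \<open>\<sigma> \<ge> 0\<close> by (simp add: D_def)
    fix n assume n: "n \<ge> N" "n > 0"
    have "D * 1 \<le> D * n" using n by (intro mult_left_mono) (auto simp: D_def)
    moreover have "2 * f n - t * (real n)\<^sup>2 = (2 * f n - t * (n * (n + 1))) + t * n"
      by (simp add: power2_eq_square algebra_simps)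
    moreover have "\<bar>t * n\<bar> = \<bar>t\<bar> * n" by (simp add: abs_mult)
    moreover have "\<sigma> * (n * (n + 1)) = \<sigma> * (real n)\<^sup>2 + \<sigma> * n"
      by (simp add: power2_eq_square algebra_simps)
    ultimately show "\<bar>2 * f n - t * (real n)\<^sup>2\<bar> \<le> \<sigma> * (real n)\<^sup>2 + (\<bar>t\<bar> + \<sigma> + D) * real n"
      using ind[OF n(1)] unfolding distrib_right by linarith
  qed
qed

section \<open>Lower bound from Turan graphs\<close>

lemma card_edges_le_ex:
  assumes "is_graph n E" "free F (n, E)"
  shows "card E \<le> ex n F"
  unfolding ex_def
proof (rule Max_ge)
  have "{card E | E. is_graph n E \<and> free F (n, E)} \<subseteq> card ` {E. is_graph n E}" by auto
  thus "finite {card E | E. is_graph n E \<and> free F (n, E)}"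
    using finite_graphs finite_surj by blast
qed (use assms in auto)

text \<open>The complete multipartite graph on the residue classes modulo \<open>r\<close> has a
  proper colouring with \<open>r\<close> colours, which every graph contained in it inherits. Each
  vertex \<open>v\<close> has at least \<open>(1 - 1/r) * v\<close> smaller neighbours.\<close>

lemma turan_graph_edges_le_ex:
  assumes "\<forall>H\<in>F. wf_graph H" and chi: "\<And>H. H \<in> F \<Longrightarrow> r < chromatic_number H" and "r > 0"
  shows "(1 - 1 / real r) * (n * (real n - 1)) \<le> 2 * real (ex n F)"
proof -
  define T where "T = {{u, v} | u v. u < n \<and> v < n \<and> u mod r \<noteq> v mod r}"
  have graph: "is_graph n T" unfolding is_graph_def T_def by fastforce
  have T: "u mod r \<noteq> v mod r" if "{u, v} \<in> T" for u v
    using that by (auto simp: T_def doubleton_eq_iff)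
  have free: "free F (n, T)"
    unfolding free_def
  proof (intro ballI notI)
    fix H assume H: "H \<in> F" and "contains (n, T) H"
    then obtain f where f: "\<And>e. e \<in> snd H \<Longrightarrow> f ` e \<in> T" by (auto simp: contains_def)
    have "proper_colouring H r (\<lambda>v. f v mod r)"
      unfolding proper_colouring_def
    proof (intro conjI ballI allI impI)
      fix e u v assume e: "e \<in> snd H" "u \<in> e" "v \<in> e" "u \<noteq> v"
      have "is_graph (fst H) (snd H)" using assms(1) H by (auto simp: wf_graph_def)
      hence "e = {u, v}" using e by (force simp: is_graph_def)
      thus "f u mod r \<noteq> f v mod r" using f[OF e(1)] T by simp
    qed (use \<open>r > 0\<close> in simp)
    hence "chromatic_number H \<le> r" unfolding chromatic_number_def by (intro Least_le) blast
    thus False using chi[OF H] by simp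
  qed
  have "finite T"
    by (rule finite_subset[of _ "Pow {..<n}"]) (auto simp: T_def)
  \<comment> \<open>Listing each edge with its larger end first makes the map to unordered pairs
    injective.\<close>
  define P where "P = (SIGMA v:{..<n}. {u. u < v \<and> u mod r \<noteq> v mod r})"
  have inj: "inj_on (\<lambda>(v, u). {u, v}) P"
    by (auto simp: inj_on_def P_def doubleton_eq_iff)
  have "(\<lambda>(v, u). {u, v}) ` P \<subseteq> T" by (fastforce simp: P_def T_def)
  hence "card P \<le> card T" using card_inj_on_le[OF inj] \<open>finite T\<close> by blast
  have row: "real v * (1 - 1 / r) \<le> card {u. u < v \<and> u mod r \<noteq> v mod r}" for v
  proof -
    \<comment> \<open>The smaller members of the class of \<open>v\<close> are among
      \<open>v - r\<close>, \<open>v - 2 * r\<close> and so on, at most \<open>v div r\<close> in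
      number.\<close>
    have "{u. u < v \<and> u mod r = v mod r} \<subseteq> (\<lambda>k. v - k * r) ` {1..v div r}"
    proof
      fix u assume "u \<in> {u. u < v \<and> u mod r = v mod r}"
      hence u: "u < v" "u mod r = v mod r" by auto
      hence "r dvd v - u" using mod_eq_dvd_iff_nat[of u v r] by simp
      then obtain k where k: "v - u = k * r" by (metis dvdE mult.commute)
      have "k \<noteq> 0" using k u by (cases k) auto
      moreover have "k \<le> v div r"
        using k \<open>r > 0\<close> by (metis diff_le_self less_eq_div_iff_mult_less_eq)
      moreover have "u = v - k * r" using k u by simp
      ultimately show "u \<in> (\<lambda>k. v - k * r) ` {1..v div r}" by auto
    qed
    hence "card {u. u < v \<and> u mod r = v mod r} \<le> v div r"
      using surj_card_le[of "{1..v div r}"] by fastforce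
    hence "real (card {u. u < v \<and> u mod r = v mod r}) \<le> v / r"
      using of_nat_div_le_of_nat[of v r, where 'a = real] by linarith
    moreover have "card {u. u < v \<and> u mod r \<noteq> v mod r} + card {u. u < v \<and> u mod r = v mod r} = card {..<v}"
      by (subst card_Un_disjoint[symmetric]) (auto intro!: arg_cong[of _ "{..<v}" card] simp del: card_lessThan)
    ultimately show ?thesis by (simp add: algebra_simps)
  qed
  have gauss: "2 * (\<Sum>v<n. real v) = n * (real n - 1)"
    by (induction n) (auto simp: algebra_simps)
  have "(\<Sum>v<n. real v * (1 - 1 / r)) \<le> (\<Sum>v<n. real (card {u. u < v \<and> u mod r \<noteq> v mod r}))"
    by (intro sum_mono row)
  also have "\<dots> = card P" unfolding P_def by (subst card_SigmaI) auto
  also have "\<dots> \<le> ex n F"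
    using \<open>card P \<le> card T\<close> card_edges_le_ex[OF graph free] by simp
  finally show ?thesis
    unfolding sum_distrib_right[symmetric] gauss[symmetric] by (simp add: mult_ac)
qed

text \<open>Comparison of the quadratic terms for large \<open>n\<close>. No limit is taken:
  \<open>t\<close> may be any constant satisfying the growth estimate.\<close>

lemma turan_density_lower:
  fixes f :: "nat \<Rightarrow> real" and a t \<sigma> C :: real
  assumes "\<And>n :: nat. a * (n * (real n - 1)) \<le> 2 * f n"
    and "\<And>n. n \<ge> N \<Longrightarrow> n > 0 \<Longrightarrow> \<bar>2 * f n - t * (real n)\<^sup>2\<bar> \<le> \<sigma> * (real n)\<^sup>2 + C * real n"
  shows "a \<le> t + \<sigma>"
proof (rule ccontr)
  assume "\<not> a \<le> t + \<sigma>"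
  then obtain m where m: "real m * (a - t - \<sigma>) > a + C"
    using reals_Archimedean3[of "a - t - \<sigma>"] by auto
  define n where "n = max (max m N) 1"
  have n: "n \<ge> N" "n > 0" "n \<ge> m" by (auto simp: n_def)
  have "a * (n * (real n - 1)) \<le> (t + \<sigma>) * (real n)\<^sup>2 + C * real n"
    using assms(1)[of n] assms(2)[OF n(1,2)] by (simp add: algebra_simps)
  hence "n * (n * (a - t - \<sigma>)) \<le> n * (a + C)"
    by (simp add: algebra_simps power2_eq_square)
  hence "n * (a - t - \<sigma>) \<le> a + C" using n by simp
  moreover have "m * (a - t - \<sigma>) \<le> n * (a - t - \<sigma>)"
    using n \<open>\<not> a \<le> t + \<sigma>\<close> by (intro mult_right_mono) auto
  ultimately show False using m by simp
qed

section \<open>Descent\<close>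

lemma finite_G'_set: "finite (G'_set F \<epsilon> n)"
  by (rule finite_subset[OF _ finite_graphs[of n]]) (auto simp: G'_set_def)

lemma lambda_alpha_le_G':
  "E \<in> G'_set F \<epsilon> n \<Longrightarrow> lambda_alpha \<alpha> n E \<le> lambda_alpha_G' F \<epsilon> \<alpha> n"
  unfolding lambda_alpha_G'_def by (intro Max_ge finite_imageI finite_G'_set imageI)

text \<open>One deletion in the form in which it is iterated. The bound with
  \<open>+ \<sigma>\<close> for the new graph will exclude it from \<open>G'_set\<close>, and the
  logarithms make the gains in the ratio of eigenvalue to order telescope.\<close>

lemma low_degree_descent:
  fixes \<alpha> \<epsilon> \<sigma> t C h :: real and f :: "nat \<Rightarrow> real"
  assumes \<epsilon>: "0 < \<epsilon>" "\<epsilon> < 1/2" and \<sigma>: "0 < \<sigma>" "\<sigma> < \<epsilon>^3 / 7"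
    and \<alpha>: "0 \<le> \<alpha>" "\<alpha> \<le> 1" "\<alpha> \<le> t + \<sigma> - \<epsilon>"
    and n: "n \<ge> 2" "56 * (C + 1) \<le> \<epsilon> * n" "2 * (C + 1) \<le> \<sigma> * (real n - 1)" "2 \<le> h\<^sup>2 * n"
    and h: "h = 6 * \<epsilon> / 7" and "C \<ge> 0"
    and f: "(t - \<sigma>) * n \<le> f n - f (n - 1)" "(t - \<sigma>) * (real n)\<^sup>2 - C * real n \<le> 2 * f n"
      "2 * f (n - 1) \<le> (t + \<sigma>) * (real n - 1)\<^sup>2 + C * (real n - 1)"
    and E: "is_graph n E" "u < n" "degree E u \<le> (t - \<epsilon>) * n"
      "2 * f n / n - \<sigma> \<le> lambda_alpha \<alpha> n E"
  obtains E' where "is_graph (n - 1) E'" "\<And>F. free F (n, E) \<Longrightarrow> free F (n - 1, E')"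
    "2 * f (n - 1) / real (n - 1) + \<sigma> < lambda_alpha \<alpha> (n - 1) E'"
    "lambda_alpha \<alpha> n E / n + h\<^sup>2 / 2 * (ln n - ln (real (n - 1)))
       \<le> lambda_alpha \<alpha> (n - 1) E' / real (n - 1)"
proof -
  define \<mu> where "\<mu> = lambda_alpha \<alpha> n E"
  define m where "m = real n"
  have m: "m \<ge> 2" "real (n - 1) = m - 1"
    using \<open>n \<ge> 2\<close> by (auto simp: m_def of_nat_diff)
  have \<epsilon>3: "\<epsilon>^3 \<le> \<epsilon> / 4"
  proof -
    have "\<epsilon> * \<epsilon> \<le> 1/2 * (1/2)" using \<epsilon> by (intro mult_mono) auto
    hence "\<epsilon> * (\<epsilon> * \<epsilon>) \<le> \<epsilon> * (1/4)" using \<epsilon> by (intro mult_left_mono) auto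
    thus ?thesis by (simp add: power3_eq_cube mult.assoc)
  qed
  \<comment> \<open>\<open>h\<^sup>2 = 36/49 * \<epsilon>\<^sup>2\<close>, and
    \<open>\<epsilon> < 1/2 < 36/49\<close>.\<close>
  have "7 * \<sigma> < h\<^sup>2"
  proof -
    have "\<epsilon>\<^sup>2 * \<epsilon> \<le> \<epsilon>\<^sup>2 * (36/49)" using \<epsilon> by (intro mult_left_mono) auto
    thus ?thesis using \<sigma> by (simp add: h power_divide power_mult_distrib power3_eq_cube power2_eq_square)
  qed
  have \<sigma>28: "28 * \<sigma> \<le> \<epsilon>" using \<sigma> \<epsilon>3 by simp
  have "\<sigma> \<le> 1" using \<sigma>28 \<epsilon> by simp
  have lower: "2 * f n \<le> m * \<mu> + \<sigma> * m"
    using E(4) m by (simp add: \<mu>_def m_def field_simps)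
  have "m * ((t - \<sigma>) * m - C) \<le> m * (\<mu> + \<sigma>)"
    using f(2) lower by (simp add: m_def power2_eq_square algebra_simps)
  hence \<mu>: "(t - \<sigma>) * m - C - \<sigma> \<le> \<mu>" using m by simp
  have \<sigma>m: "28 * (\<sigma> * m) \<le> \<epsilon> * m" using \<sigma>28 m mult_right_mono[of "28 * \<sigma>" \<epsilon> m] by simp
  have slack: "56 * (C + \<sigma>) \<le> \<epsilon> * m"
    using n(2) \<open>\<sigma> \<le> 1\<close> by (simp add: m_def)
  define a b d where "a = \<epsilon> * m" and "b = \<sigma> * m" and "d = t * m"
  have expand: "(t - \<epsilon>) * m = d - a" "(t - \<sigma>) * m = d - b" "(t + \<sigma> - \<epsilon>) * m = d + b - a"
    "7 * (h * m) = 6 * a"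
    by (simp_all add: h a_def b_def d_def ring_distribs)
  have "0 \<le> a" "28 * b \<le> a" "56 * (C + \<sigma>) \<le> a" using \<epsilon> m \<sigma>m slack by (simp_all add: a_def b_def)
  moreover have "d - b - C - \<sigma> \<le> \<mu>" using \<mu> by (simp add: expand)
  \<comment> \<open>Since \<open>h * m = 6/7 * a\<close>, a margin of \<open>a / 7\<close> is
    available. The losses \<open>b + C + \<sigma>\<close> and \<open>2 * b + C + \<sigma>\<close>
    are at most \<open>3/56 * a\<close> and \<open>5/56 * a\<close>.\<close>
  ultimately have room: "d - a + h * m \<le> \<mu>" "h * m \<le> \<mu> - (d + b - a)"
    using expand(4) by argo+
  have "degree E u + h * m \<le> \<mu>"
    using E(3) room(1) expand(1) by (simp add: m_def)
  moreover have "\<alpha> * m \<le> d + b - a"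
    using \<alpha> m unfolding expand(3)[symmetric] by (intro mult_right_mono) auto
  hence \<alpha>m: "h * m \<le> \<mu> - \<alpha> * m" using room(2) by simp
  moreover have "0 < h" "h \<le> 1/2" using \<epsilon> by (auto simp: h)
  moreover have "0 \<le> h * m" using \<open>0 < h\<close> m by simp
  ultimately have "degree E u + h * m \<le> \<mu>" "\<alpha> * m \<le> \<mu>" by linarith+
  hence hyps: "degree E u + h * n \<le> lambda_alpha \<alpha> n E" "\<alpha> * n \<le> lambda_alpha \<alpha> n E"
    by (simp_all add: \<mu>_def m_def)
  obtain E' where E': "is_graph (n - 1) E'" "\<And>F. free F (n, E) \<Longrightarrow> free F (n - 1, E')"
    "(real n - 2) * lambda_alpha \<alpha> n E + h * (lambda_alpha \<alpha> n E - \<alpha> * n)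
       \<le> (real n - 1) * lambda_alpha \<alpha> (n - 1) E'"
    by (rule descent_step[OF E(1) \<open>n \<ge> 2\<close> \<alpha>(1,2) \<open>0 < h\<close> \<open>h \<le> 1/2\<close> E(2) hyps]) (rule that)
  define \<nu> where "\<nu> = lambda_alpha \<alpha> (n - 1) E'"
  have "h * (h * m) \<le> h * (\<mu> - \<alpha> * m)" using \<alpha>m \<open>0 < h\<close> by (intro mult_left_mono) auto
  hence step: "(m - 2) * \<mu> + h\<^sup>2 * m \<le> (m - 1) * \<nu>"
    using E'(3) m by (simp add: \<mu>_def \<nu>_def m_def power2_eq_square)
  have "\<mu> \<le> m" unfolding \<mu>_def m_def
    using lambda_alpha_le[OF E(1) _ \<alpha>(1,2)] \<open>n \<ge> 2\<close> by simp
  \<comment> \<open>As \<open>(m - 1)\<^sup>2 = m * (m - 2) + 1\<close>, passing to ratios costs one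
    extra \<open>\<mu> \<le> m\<close>. Half of the gain \<open>h\<^sup>2 * m\<^sup>2\<close> pays
    for it because \<open>h\<^sup>2 * m \<ge> 2\<close>.\<close>
  have ratio: "\<mu> / m + h\<^sup>2 / 2 / (m - 1) \<le> \<nu> / (m - 1)"
  proof -
    have *: "m * ((m - 2) * \<mu> + h\<^sup>2 * m) \<le> m * ((m - 1) * \<nu>)"
      "2 * m \<le> h\<^sup>2 * m * m" "0 \<le> h\<^sup>2 * m"
      using step m n(4) by (auto simp: m_def intro!: mult_left_mono mult_right_mono)
    have "(m - 1) * (\<mu> * (m - 1) + h\<^sup>2 / 2 * m) \<le> (m - 1) * (\<nu> * m)"
    proof -
      have "(m - 1) * (\<nu> * m) - (m - 1) * (\<mu> * (m - 1) + h\<^sup>2 / 2 * m) =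
        (m * ((m - 1) * \<nu>) - m * ((m - 2) * \<mu> + h\<^sup>2 * m))
        + (h\<^sup>2 * m * m - 2 * m) / 2 + (m - \<mu>) + h\<^sup>2 * m / 2"
        by (simp add: field_simps)
      thus ?thesis using * \<open>\<mu> \<le> m\<close> by argo
    qed
    hence "\<mu> * (m - 1) + h\<^sup>2 / 2 * m \<le> \<nu> * m"
      by (rule mult_left_le_imp_le) (use m in simp)
    hence "(\<mu> * (m - 1) + h\<^sup>2 / 2 * m) / (m * (m - 1)) \<le> \<nu> * m / (m * (m - 1))"
      by (rule divide_right_mono) (use m in simp)
    thus ?thesis using m by (simp add: add_divide_distrib)
  qed
  have "ln m - ln (m - 1) = ln (m / (m - 1))" using m by (simp add: ln_div)
  also have "\<dots> \<le> m / (m - 1) - 1" using m by (intro ln_le_minus_one) auto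
  also have "\<dots> = 1 / (m - 1)" using m by (simp add: field_simps)
  finally have "h\<^sup>2 / 2 * (ln m - ln (m - 1)) \<le> h\<^sup>2 / 2 * (1 / (m - 1))"
    by (rule mult_left_mono) simp
  hence growth: "\<mu> / m + h\<^sup>2 / 2 * (ln m - ln (m - 1)) \<le> \<nu> / (m - 1)"
    using ratio by (simp only: times_divide_eq_right mult_1_right)
  have "2 * f (n - 1) + \<sigma> * (m - 1) < (m - 1) * \<nu>"
  proof (cases "2 * \<mu> \<le> 2 * t * m + 3 * \<sigma> * m")
    \<comment> \<open>After inserting \<open>step\<close> and the bound on \<open>f (n - 1)\<close>,
      the gain \<open>h\<^sup>2 * m\<close> has to exceed
      \<open>2 * \<mu> - 2 * t * m + 4 * \<sigma> * m - \<sigma>\<close>, which is below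
      \<open>7 * \<sigma> * m\<close> in this case.\<close>
    case True
    have "7 * \<sigma> * m < h\<^sup>2 * m" using \<open>7 * \<sigma> < h\<^sup>2\<close> m by (intro mult_strict_right_mono) auto
    moreover have "2 * f (n - 1) \<le> m * \<mu> + \<sigma> * m - 2 * ((t - \<sigma>) * m)"
      using f(1) lower by (simp add: m_def)
    ultimately show ?thesis using True step \<sigma> by (simp add: algebra_simps)
  next
    \<comment> \<open>The ratio does not decrease and so stays above
      \<open>t + 3/2 * \<sigma>\<close>, while the bound on \<open>f (n - 1)\<close> has leading
      coefficient \<open>t + \<sigma>\<close>. The surplus \<open>\<sigma> / 2 * (m - 1)\<close>
      absorbs \<open>C + \<sigma>\<close>.\<close>
    case False
    have "0 \<le> h\<^sup>2 / 2 / (m - 1)" using m by simp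
    hence "\<mu> / m \<le> \<nu> / (m - 1)" using ratio by linarith
    moreover have "t + 3/2 * \<sigma> < \<mu> / m" using False m by (simp add: field_simps)
    ultimately have "t + 3/2 * \<sigma> < \<nu> / (m - 1)" by simp
    hence "(t + 3/2 * \<sigma>) * (m - 1) < \<nu>" using m by (simp add: field_simps)
    hence last: "(m - 1) * ((t + 3/2 * \<sigma>) * (m - 1)) < (m - 1) * \<nu>"
      using m by (intro mult_strict_left_mono) auto
    define k where "k = m - 1"
    have "k * (2 * (C + 1)) \<le> k * (\<sigma> * k)"
      using n(3) m by (intro mult_left_mono) (auto simp: m_def k_def)
    moreover have "k * (2 * (C + 1)) = 2 * (C * k + k)" by (simp add: algebra_simps)
    ultimately have "C * k + k \<le> k * (\<sigma> * k) / 2" by simp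
    moreover have "\<sigma> * k \<le> 1 * k" using \<open>\<sigma> \<le> 1\<close> m by (intro mult_right_mono) (auto simp: k_def)
    moreover have "2 * f (n - 1) \<le> (t + \<sigma>) * k\<^sup>2 + C * k" using f(3) by (simp add: m_def k_def)
    ultimately have "2 * f (n - 1) + \<sigma> * k \<le> (t + \<sigma>) * k\<^sup>2 + k * (\<sigma> * k) / 2" by simp
    also have "\<dots> = k * ((t + 3/2 * \<sigma>) * k)" by (simp add: algebra_simps power2_eq_square)
    finally show ?thesis using last unfolding k_def by (rule le_less_trans)
  qed
  hence "2 * f (n - 1) / (m - 1) + \<sigma> < \<nu>" using m by (simp add: field_simps)
  with growth show thesis
    unfolding \<mu>_def \<nu>_def m(2)[symmetric]
    using that[OF E'(1)] E'(2) by (simp add: m_def)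
qed

theorem theorem5p1:
  fixes \<F> :: "graph set" and r :: nat and \<epsilon> \<sigma> \<alpha> :: real
  assumes "\<F> \<noteq> {}"
    and "\<forall>H\<in>\<F>. wf_graph H"
    and "chromatic_number_fam \<F> = r + 1" and "r + 1 \<ge> 3"
    and "0 < \<epsilon>" and "\<epsilon> < 1/2"
    and "0 < \<sigma>" and "\<sigma> < \<epsilon>^3 / 7"
    and "0 \<le> \<alpha>" and "\<alpha> \<le> 1 - 1 / real r - \<epsilon>"
    and "\<exists>N>0. \<forall>n>N.
           \<bar>real (ex n \<F>) - real (ex (n - 1) \<F>) - turan_density \<F> * real n\<bar> \<le> \<sigma> * real n
         \<and> \<bar>lambda_alpha_G' \<F> \<epsilon> \<alpha> n - 2 * real (ex n \<F>) / real n\<bar> \<le> \<sigma>"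
  shows "\<exists>n0>0. \<forall>n\<ge>n0. \<forall>E. is_graph n E \<and> free \<F> (n, E) \<longrightarrow>
           lambda_alpha \<alpha> n E \<le> lambda_alpha_G' \<F> \<epsilon> \<alpha> n
         \<and> (lambda_alpha \<alpha> n E = lambda_alpha_G' \<F> \<epsilon> \<alpha> n \<longrightarrow> E \<in> G'_set \<F> \<epsilon> n)"
proof -
  define t where "t = turan_density \<F>"
  define f where "f n = real (ex n \<F>)" for n
  define h where "h = 6 * \<epsilon> / 7"
  have "h > 0" using \<open>0 < \<epsilon>\<close> by (simp add: h_def)
  obtain N where N: "\<And>n. n > N \<Longrightarrow> \<bar>f n - f (n - 1) - t * n\<bar> \<le> \<sigma> * n"
    "\<And>n. n > N \<Longrightarrow> \<bar>lambda_alpha_G' \<F> \<epsilon> \<alpha> n - 2 * f n / n\<bar> \<le> \<sigma>"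
    using assms(11) unfolding t_def f_def by blast
  obtain C :: real where C: "C \<ge> 0" "\<And>n. n \<ge> N \<Longrightarrow> n > 0 \<Longrightarrow> \<bar>2 * f n - t * (real n)\<^sup>2\<bar> \<le> \<sigma> * (real n)\<^sup>2 + C * real n"
    using quadratic_growth[OF N(1)] \<open>0 < \<sigma>\<close> by (metis less_imp_le)
  have "r < chromatic_number H" if "H \<in> \<F>" for H
  proof -
    have "chromatic_number_fam \<F> \<le> chromatic_number H"
      unfolding chromatic_number_fam_def using that by (intro Least_le) simp
    thus ?thesis using assms(3) by simp
  qed
  hence turan: "(1 - 1 / real r) * (n * (real n - 1)) \<le> 2 * f n" for n
    unfolding f_def using turan_graph_edges_le_ex[OF assms(2)] \<open>r + 1 \<ge> 3\<close> by simp
  have "1 - 1 / real r \<le> t + \<sigma>" by (rule turan_density_lower[OF turan C(2)])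
  hence \<alpha>: "0 \<le> \<alpha>" "\<alpha> \<le> 1" "\<alpha> \<le> t + \<sigma> - \<epsilon>"
  proof -
    have "0 \<le> 1 / real r" by simp
    thus "0 \<le> \<alpha>" "\<alpha> \<le> 1" "\<alpha> \<le> t + \<sigma> - \<epsilon>"
      using assms(5,9,10) \<open>1 - 1 / real r \<le> t + \<sigma>\<close> by linarith+
  qed
  obtain n1 where n1: "n1 > N + 2"
    "56 * (C + 1) \<le> \<epsilon> * n1" "2 * (C + 1) \<le> \<sigma> * (real n1 - 1)" "2 \<le> h\<^sup>2 * n1"
  proof
    define n1 where "n1 = nat \<lceil>56 * (C + 1) / \<epsilon>\<rceil> + nat \<lceil>2 * (C + 1) / \<sigma>\<rceil> + nat \<lceil>2 / h\<^sup>2\<rceil> + N + 3"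
    have "56 * (C + 1) / \<epsilon> \<le> n1" "2 * (C + 1) / \<sigma> \<le> real n1 - 1" "2 / h\<^sup>2 \<le> n1"
      unfolding n1_def by linarith+
    thus "56 * (C + 1) \<le> \<epsilon> * n1" "2 * (C + 1) \<le> \<sigma> * (real n1 - 1)" "2 \<le> h\<^sup>2 * n1"
      using \<open>0 < \<epsilon>\<close> \<open>0 < \<sigma>\<close> \<open>h > 0\<close> by (simp_all add: field_simps)
    show "n1 > N + 2" by (simp add: n1_def)
  qed
  define c where "c = h\<^sup>2 / 2"
  have "c > 0" using \<open>h > 0\<close> by (simp add: c_def)
  have step: "\<exists>E'. is_graph (n - 1) E' \<and> free \<F> (n - 1, E')
      \<and> 2 * f (n - 1) / real (n - 1) + \<sigma> < lambda_alpha \<alpha> (n - 1) E'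
      \<and> lambda_alpha \<alpha> n E / n + c * (ln n - ln (real (n - 1))) \<le> lambda_alpha \<alpha> (n - 1) E' / real (n - 1)"
    if "n \<ge> n1" and E: "is_graph n E" "free \<F> (n, E)" "E \<notin> G'_set \<F> \<epsilon> n"
      "2 * f n / n - \<sigma> \<le> lambda_alpha \<alpha> n E" for n E
  proof -
    obtain u where u: "u < n" "degree E u \<le> (t - \<epsilon>) * n"
      using E(1-3) by (auto simp: G'_set_def t_def not_less)
    have n: "n > N" "n - 1 \<ge> N" "n - 1 > 0" "n \<ge> 2" using n1(1) \<open>n \<ge> n1\<close> by auto
    have "\<epsilon> * n1 \<le> \<epsilon> * n" "\<sigma> * (real n1 - 1) \<le> \<sigma> * (real n - 1)" "h\<^sup>2 * n1 \<le> h\<^sup>2 * n"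
      using \<open>n \<ge> n1\<close> \<open>0 < \<epsilon>\<close> \<open>0 < \<sigma>\<close> by (auto intro!: mult_left_mono)
    hence big: "56 * (C + 1) \<le> \<epsilon> * n" "2 * (C + 1) \<le> \<sigma> * (real n - 1)" "2 \<le> h\<^sup>2 * n"
      using n1 by auto
    have f: "(t - \<sigma>) * n \<le> f n - f (n - 1)" "(t - \<sigma>) * (real n)\<^sup>2 - C * real n \<le> 2 * f n"
      "2 * f (n - 1) \<le> (t + \<sigma>) * (real n - 1)\<^sup>2 + C * (real n - 1)"
      using N(1)[OF n(1)] C(2)[of n] C(2)[OF n(2,3)] n
      by (auto simp: algebra_simps of_nat_diff)
    show ?thesis
      by (rule low_degree_descent[OF assms(5-8) \<alpha> n(4) big h_def C(1) f E(1) u E(4)])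
        (use E(2) n in \<open>auto simp: c_def\<close>)
  qed
  \<comment> \<open>The number of deletions is \<open>Suc k\<close>: the first one starts from the
    weaker bound with \<open>- \<sigma>\<close>, all later ones from \<open>+ \<sigma>\<close>. The
    condition \<open>n1 + k < n\<close> keeps the final order at least \<open>n1\<close>.\<close>
  have descent: "\<exists>E'. is_graph (n - Suc k) E' \<and> free \<F> (n - Suc k, E')
      \<and> 2 * f (n - Suc k) / real (n - Suc k) + \<sigma> < lambda_alpha \<alpha> (n - Suc k) E'
      \<and> lambda_alpha \<alpha> n E / n + c * (ln n - ln (real (n - Suc k)))
          \<le> lambda_alpha \<alpha> (n - Suc k) E' / real (n - Suc k)"
    if n: "n1 + k < n" and E: "is_graph n E" "free \<F> (n, E)" "E \<notin> G'_set \<F> \<epsilon> n"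
      "2 * f n / n - \<sigma> \<le> lambda_alpha \<alpha> n E" for n E k
    using n
  proof (induction k)
    case 0
    show ?case using step[of n E] E 0 by simp
  next
    case (Suc k)
    define m where "m = n - Suc k"
    have m: "m \<ge> n1" "m > N" using Suc.prems n1(1) by (auto simp: m_def)
    obtain E' where E': "is_graph m E'" "free \<F> (m, E')" "2 * f m / m + \<sigma> < lambda_alpha \<alpha> m E'"
      "lambda_alpha \<alpha> n E / n + c * (ln n - ln m) \<le> lambda_alpha \<alpha> m E' / m"
      using Suc unfolding m_def by auto
    \<comment> \<open>Members of \<open>G'_set\<close> have eigenvalue at most
      \<open>2 * f m / m + \<sigma>\<close>, which \<open>E'\<close> exceeds.\<close>
    have "E' \<notin> G'_set \<F> \<epsilon> m"
    proof
      assume "E' \<in> G'_set \<F> \<epsilon> m"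
      from lambda_alpha_le_G'[OF this, of \<alpha>] show False using N(2)[OF m(2)] E'(3) by simp
    qed
    then obtain E'' where E'': "is_graph (m - 1) E''" "free \<F> (m - 1, E'')"
      "2 * f (m - 1) / real (m - 1) + \<sigma> < lambda_alpha \<alpha> (m - 1) E''"
      "lambda_alpha \<alpha> m E' / m + c * (ln m - ln (real (m - 1))) \<le> lambda_alpha \<alpha> (m - 1) E'' / real (m - 1)"
      using step[OF m(1) E'(1,2)] E'(3) \<open>0 < \<sigma>\<close> by force
    have "lambda_alpha \<alpha> n E / n + c * (ln n - ln (real (m - 1)))
        \<le> lambda_alpha \<alpha> (m - 1) E'' / real (m - 1)"
      using E'(4) E''(4) by (simp add: algebra_simps)
    moreover have "m - 1 = n - Suc (Suc k)" by (simp add: m_def)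
    ultimately show ?case using E'' by auto
  qed
  \<comment> \<open>From \<open>n1 * exp (3 / c)\<close> on, the logarithmic gain down to order
    \<open>n1\<close> is at least 3, whereas the ratio starts at -1 or more and has to end at 1 or
    less.\<close>
  define n0 where "n0 = nat \<lceil>n1 * exp (3 / c)\<rceil> + n1 + 1"
  have "lambda_alpha \<alpha> n E < lambda_alpha_G' \<F> \<epsilon> \<alpha> n"
    if n: "n \<ge> n0" and E: "is_graph n E" "free \<F> (n, E)" "E \<notin> G'_set \<F> \<epsilon> n" for n E
  proof (rule ccontr)
    assume "\<not> lambda_alpha \<alpha> n E < lambda_alpha_G' \<F> \<epsilon> \<alpha> n"
    moreover have "n > n1" using n by (simp add: n0_def)
    ultimately have lower: "2 * f n / n - \<sigma> \<le> lambda_alpha \<alpha> n E"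
      using N(2)[of n] n1(1) by force
    \<comment> \<open>With \<open>k = n - n1 - 1\<close> the descent ends exactly at order
      \<open>n1\<close>.\<close>
    obtain E' where E': "is_graph n1 E'"
      "lambda_alpha \<alpha> n E / n + c * (ln n - ln n1) \<le> lambda_alpha \<alpha> n1 E' / n1"
      using descent[of "n - n1 - 1" n E] E lower \<open>n > n1\<close> by force
    have "n1 * exp (3 / c) \<le> n" using n unfolding n0_def by linarith
    hence "ln (n1 * exp (3 / c)) \<le> ln n" using n1(1) by (intro ln_mono) auto
    hence "3 / c \<le> ln n - ln n1" using n1(1) by (simp add: ln_mult)
    hence "3 \<le> c * (ln n - ln n1)" using \<open>c > 0\<close> by (simp add: field_simps)
    moreover have "-1 \<le> lambda_alpha \<alpha> n E / n"
    proof -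
      have "\<epsilon>^3 \<le> 1" using assms(5,6) by (intro power_le_one) auto
      hence "\<sigma> \<le> n" using \<open>\<sigma> < \<epsilon>^3 / 7\<close> \<open>n > n1\<close> by simp
      moreover have "0 \<le> 2 * f n / n" by (simp add: f_def)
      ultimately have "- real n \<le> lambda_alpha \<alpha> n E" using lower by linarith
      thus ?thesis using \<open>n > n1\<close> by (simp add: field_simps)
    qed
    moreover have "lambda_alpha \<alpha> n1 E' / n1 \<le> 1"
      using lambda_alpha_le[OF E'(1) _ \<alpha>(1,2)] n1(1) by (simp add: divide_le_eq)
    ultimately show False using E'(2) by simp
  qed
  moreover have "n0 > 0" by (simp add: n0_def)
  \<comment> \<open>Graphs outside \<open>G'_set\<close> lie strictly below the maximum, which
    settles the equality case as well.\<close>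
  ultimately show ?thesis
    using lambda_alpha_le_G' by (intro exI[of _ n0]) (metis less_imp_le less_irrefl)
qed

end
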